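(* Suppose Assumption 1 (stated in the context) holds, $p_1>\alpha$ and $p_2>1$. Then each player's maximin and minimax payoffs equal the Nash equilibrium payoff $0$: $$\max_{\sigma^1}\min_{\sigma^2}U_1(\sigma^1,\sigma^2)=0=\min_{\sigma^2}\max_{\sigma^1}U_1(\sigma^1,\sigma^2),$$ $$\max_{\sigma^2}\min_{\sigma^1}U_2(\sigma^1,\sigma^2)=0=\min_{\sigma^1}\max_{\sigma^2}U_2(\sigma^1,\sigma^2),$$ where $\sigma^1$ ranges over $\Delta(\mathcal{F})$ and $\sigma^2$ over $\Delta(\mathcal{A})$. Furthermore, any Nash equilibrium consists of minimaximizers: for every $({\sigma^1}^*,{\sigma^2}^* )\in\mathcal{S}_\Gamma$, ${\sigma^1}^*$ minimizes $\sigma^1\mapsto\max_{\sigma^2}U_2(\sigma^1,\sigma^2)$ over $\Delta(\mathcal{F})$ and ${\sigma^2}^*$ minimizes $\sigma^2\mapsto\max_{\sigma^1}U_1(\sigma^1,\sigma^2)$ over $\Delta(\mathcal{A})$.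
   Context: Network. $\mathcal{G}=(\mathcal{V},\mathcal{E})$ is a finite directed graph with source $s$ and destination $t\neq s$, having at least one $s$-$t$ path; each edge $(i,j)$ has a capacity $c_{ij}>0$ and a unit transportation cost $b_{ij}>0$. $\Lambda_{path}$ is the set of (simple directed) $s$-$t$ paths and $\Lambda$ is the set of all $s$-$t$ paths and all loops (simple directed cycles). A feasible flow $x$ is given by nonnegative amounts $(x_\lambda)_{\lambda\in\Lambda}$ whose edge flows $x_{ij}=\sum_{\lambda\in\Lambda:(i,j)\in\lambda}x_\lambda$ satisfy $x_{ij}\le c_{ij}$ for all $(i,j)\in\mathcal{E}$; $\mathcal{F}$ is the set of feasible flows. $F(x)=\sum_{\lambda\in\Lambda_{path}}x_\lambda$ is the amount of flow passing from $s$ to $t$, and $C_1(x)=\sum_{(i,j)\in\mathcal{E}}b_{ij}x_{ij}$. $\Theta=\max_{x\in\mathcal{F}}F(x)$. $\Omega$ is the set of maximum flows of minimum transportation cost, i.e. minimizers of $C_1$ over $\{x\in\mathcal{F}: F(x)=\Theta\}$. Attacks. $\mathcal{A}=\{0,1\}^{\mathcal{E}}$; $\mu_{ij}=1$ means edge $(i,j)$ is disrupted. $C_2(\mu)=\sum_{(i,j)\in\mathcal{E}}c_{ij}\mu_{ij}$. The effective flow $x^\mu$ has $x^\mu_\lambda=x_\lambda$ if $\lambda$ contains no disrupted edge and $x^\mu_\lambda=0$ otherwise; $F(x-x^\mu)=F(x)-F(x^\mu)$ is the lost flow. Game $\Gamma$. Player 1 chooses $x\in\mathcal{F}$ and player 2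 simultaneously chooses $\mu\in\mathcal{A}$. With $p_1,p_2>0$, payoffs are $u_1(x,\mu)=p_1F(x^\mu)-C_1(x)$ and $u_2(x,\mu)=p_2F(x-x^\mu)-C_2(\mu)$. Mixed strategies: $\Delta(\mathcal{F})=\{\sigma^1\in[0,1]^{\mathcal{F}}:\sum_{x}\sigma^1_x=1\}$ and $\Delta(\mathcal{A})=\{\sigma^2\in[0,1]^{\mathcal{A}}:\sum_\mu\sigma^2_\mu=1\}$. For $\sigma=(\sigma^1,\sigma^2)$, $\mathbb{E}_\sigma[\varphi(x,\mu)]=\sum_x\sigma^1_x\sum_\mu\sigma^2_\mu\varphi(x,\mu)$ and $U_k(\sigma^1,\sigma^2)=\mathbb{E}_\sigma[u_k(x,\mu)]$. $\mathcal{S}_\Gamma$ is the set of mixed Nash equilibria: pairs $({\sigma^1}^*,{\sigma^2}^* )$ with $U_1({\sigma^1}^*,{\sigma^2}^* )\ge U_1(\sigma^1,{\sigma^2}^* )$ for all $\sigma^1\in\Delta(\mathcal{F})$ and $U_2({\sigma^1}^*,{\sigma^2}^* )\ge U_2({\sigma^1}^*,\sigma^2)$ for all $\sigma^2\in\Delta(\mathcal{A})$. Assumption 1. Let $\alpha=\min_{\lambda\in\Lambda_{path}}\sum_{(i,j)\in\lambda}b_{ij}$. There exists $x^*\in\Omega$ such that for every $\lambda\in\Lambda_{path}$, $x^*_\lambda>0$ implies $\sum_{(i,j)\in\lambda}b_{ij}=\alpha$. *)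

theory Defs
  imports "HOL-Analysis.Analysis" "Graph_Theory.Pair_Digraph"
begin

text \<open>A path or loop is represented by its set of edges. This determines a simple path
  uniquely, and it identifies the arc lists of one simple cycle that differ only in the
  starting vertex, so that each loop carries a single amount of flow.\<close>

type_synonym 'v route = "('v \<times> 'v) set"
type_synonym 'v flow = "'v route \<Rightarrow> real"
type_synonym 'v attack = "'v \<times> 'v \<Rightarrow> real"

definition st_paths :: "'v pair_pre_digraph \<Rightarrow> 'v \<Rightarrow> 'v \<Rightarrow> 'v route set" where
  "st_paths G s t = {set p | p. pre_digraph.apath (with_proj G) s p t}"

definition loops :: "'v pair_pre_digraph \<Rightarrow> 'v route set" where
  "loops G = {set p | p. pre_digraph.cycle (with_proj G) p}"

definition routes :: "'v pair_pre_digraph \<Rightarrow> 'v \<Rightarrow> 'v \<Rightarrow> 'v route set" where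
  "routes G s t = st_paths G s t \<union> loops G"

locale flow_network = pair_fin_digraph G
  for G :: "'v pair_pre_digraph" and s t :: 'v and c b :: "'v \<times> 'v \<Rightarrow> real" +
  assumes source_in_verts: "s \<in> pverts G"
    and dest_in_verts: "t \<in> pverts G"
    and dest_neq_source: "t \<noteq> s"
    and st_path_exists: "st_paths G s t \<noteq> {}"
    and capacity_pos: "\<And>e. e \<in> parcs G \<Longrightarrow> c e > 0"
    and unit_cost_pos: "\<And>e. e \<in> parcs G \<Longrightarrow> b e > 0"

definition edge_flow :: "'v pair_pre_digraph \<Rightarrow> 'v \<Rightarrow> 'v \<Rightarrow> 'v flow \<Rightarrow> 'v \<times> 'v \<Rightarrow> real" where
  "edge_flow G s t x e = (\<Sum>l\<in>{l \<in> routes G s t. e \<in> l}. x l)"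

text \<open>Flows and attacks are extensional functions, so that the strategy sets are literally
  subsets of the function spaces over the routes and over the edges.\<close>

definition feasible_flows ::
    "'v pair_pre_digraph \<Rightarrow> 'v \<Rightarrow> 'v \<Rightarrow> ('v \<times> 'v \<Rightarrow> real) \<Rightarrow> 'v flow set" where
  "feasible_flows G s t c =
     {x \<in> routes G s t \<rightarrow>\<^sub>E {0..}. \<forall>e\<in>parcs G. edge_flow G s t x e \<le> c e}"

definition attacks :: "'v pair_pre_digraph \<Rightarrow> 'v attack set" where
  "attacks G = parcs G \<rightarrow>\<^sub>E {0, 1}"

definition flow_value :: "'v pair_pre_digraph \<Rightarrow> 'v \<Rightarrow> 'v \<Rightarrow> 'v flow \<Rightarrow> real" where
  "flow_value G s t x = (\<Sum>l\<in>st_paths G s t. x l)"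

definition transport_cost ::
    "'v pair_pre_digraph \<Rightarrow> 'v \<Rightarrow> 'v \<Rightarrow> ('v \<times> 'v \<Rightarrow> real) \<Rightarrow> 'v flow \<Rightarrow> real" where
  "transport_cost G s t b x = (\<Sum>e\<in>parcs G. b e * edge_flow G s t x e)"

definition attack_cost ::
    "'v pair_pre_digraph \<Rightarrow> ('v \<times> 'v \<Rightarrow> real) \<Rightarrow> 'v attack \<Rightarrow> real" where
  "attack_cost G c \<mu> = (\<Sum>e\<in>parcs G. c e * \<mu> e)"

definition effective_flow ::
    "'v pair_pre_digraph \<Rightarrow> 'v \<Rightarrow> 'v \<Rightarrow> 'v flow \<Rightarrow> 'v attack \<Rightarrow> 'v flow" where
  "effective_flow G s t x \<mu> =
     (\<lambda>l\<in>routes G s t. if \<exists>e\<in>l. \<mu> e = 1 then 0 else x l)"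

definition flow_diff ::
    "'v pair_pre_digraph \<Rightarrow> 'v \<Rightarrow> 'v \<Rightarrow> 'v flow \<Rightarrow> 'v flow \<Rightarrow> 'v flow" where
  "flow_diff G s t x y = (\<lambda>l\<in>routes G s t. x l - y l)"

definition route_cost :: "('v \<times> 'v \<Rightarrow> real) \<Rightarrow> 'v route \<Rightarrow> real" where
  "route_cost b l = (\<Sum>e\<in>l. b e)"

definition min_path_cost ::
    "'v pair_pre_digraph \<Rightarrow> 'v \<Rightarrow> 'v \<Rightarrow> ('v \<times> 'v \<Rightarrow> real) \<Rightarrow> real" where
  "min_path_cost G s t b = Min (route_cost b ` st_paths G s t)"

text \<open>In a flow network the supremum below is a maximum, by compactness of the set of
  feasible flows.\<close>

definition max_flow_value ::
    "'v pair_pre_digraph \<Rightarrow> 'v \<Rightarrow> 'v \<Rightarrow> ('v \<times> 'v \<Rightarrow> real) \<Rightarrow> real" where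
  "max_flow_value G s t c = (SUP x\<in>feasible_flows G s t c. flow_value G s t x)"

definition min_cost_max_flows ::
    "'v pair_pre_digraph \<Rightarrow> 'v \<Rightarrow> 'v \<Rightarrow> ('v \<times> 'v \<Rightarrow> real) \<Rightarrow> ('v \<times> 'v \<Rightarrow> real) \<Rightarrow> 'v flow set"
  where
  "min_cost_max_flows G s t c b =
     {x. is_arg_min (transport_cost G s t b)
           (\<lambda>x. x \<in> feasible_flows G s t c \<and> flow_value G s t x = max_flow_value G s t c) x}"

definition cheapest_path_assumption ::
    "'v pair_pre_digraph \<Rightarrow> 'v \<Rightarrow> 'v \<Rightarrow> ('v \<times> 'v \<Rightarrow> real) \<Rightarrow> ('v \<times> 'v \<Rightarrow> real) \<Rightarrow> bool" where
  "cheapest_path_assumption G s t c b \<longleftrightarrow>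
     (\<exists>x\<in>min_cost_max_flows G s t c b.
        \<forall>l\<in>st_paths G s t. x l > 0 \<longrightarrow> route_cost b l = min_path_cost G s t b)"

definition payoff1 ::
    "'v pair_pre_digraph \<Rightarrow> 'v \<Rightarrow> 'v \<Rightarrow> ('v \<times> 'v \<Rightarrow> real) \<Rightarrow> real \<Rightarrow>
      'v flow \<Rightarrow> 'v attack \<Rightarrow> real" where
  "payoff1 G s t b p1 x \<mu> =
     p1 * flow_value G s t (effective_flow G s t x \<mu>) - transport_cost G s t b x"

definition payoff2 ::
    "'v pair_pre_digraph \<Rightarrow> 'v \<Rightarrow> 'v \<Rightarrow> ('v \<times> 'v \<Rightarrow> real) \<Rightarrow> real \<Rightarrow>
      'v flow \<Rightarrow> 'v attack \<Rightarrow> real" where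
  "payoff2 G s t c p2 x \<mu> =
     p2 * flow_value G s t (flow_diff G s t x (effective_flow G s t x \<mu>)) - attack_cost G c \<mu>"

definition mixed_strategies :: "'a set \<Rightarrow> ('a \<Rightarrow> real) set" where
  "mixed_strategies S = {\<sigma> \<in> S \<rightarrow>\<^sub>E {0..1}. (\<sigma> has_sum 1) S}"

definition expected ::
    "'a set \<Rightarrow> 'b set \<Rightarrow> ('a \<Rightarrow> real) \<Rightarrow> ('b \<Rightarrow> real) \<Rightarrow> ('a \<Rightarrow> 'b \<Rightarrow> real) \<Rightarrow> real" where
  "expected A B \<sigma>1 \<sigma>2 \<phi> = (\<Sum>\<^sub>\<infinity>x\<in>A. \<sigma>1 x * (\<Sum>\<^sub>\<infinity>\<mu>\<in>B. \<sigma>2 \<mu> * \<phi> x \<mu>))"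

definition U1 ::
    "'v pair_pre_digraph \<Rightarrow> 'v \<Rightarrow> 'v \<Rightarrow> ('v \<times> 'v \<Rightarrow> real) \<Rightarrow> ('v \<times> 'v \<Rightarrow> real) \<Rightarrow> real \<Rightarrow>
      ('v flow \<Rightarrow> real) \<Rightarrow> ('v attack \<Rightarrow> real) \<Rightarrow> real" where
  "U1 G s t c b p1 \<sigma>1 \<sigma>2 =
     expected (feasible_flows G s t c) (attacks G) \<sigma>1 \<sigma>2 (payoff1 G s t b p1)"

definition U2 ::
    "'v pair_pre_digraph \<Rightarrow> 'v \<Rightarrow> 'v \<Rightarrow> ('v \<times> 'v \<Rightarrow> real) \<Rightarrow> real \<Rightarrow>
      ('v flow \<Rightarrow> real) \<Rightarrow> ('v attack \<Rightarrow> real) \<Rightarrow> real" where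
  "U2 G s t c p2 \<sigma>1 \<sigma>2 =
     expected (feasible_flows G s t c) (attacks G) \<sigma>1 \<sigma>2 (payoff2 G s t c p2)"

definition nash_equilibria ::
    "'a set \<Rightarrow> 'b set \<Rightarrow> ('a \<Rightarrow> 'b \<Rightarrow> real) \<Rightarrow> ('a \<Rightarrow> 'b \<Rightarrow> real) \<Rightarrow> ('a \<times> 'b) set" where
  "nash_equilibria A B f g =
     {(a, b). a \<in> A \<and> b \<in> B \<and> (\<forall>a'\<in>A. f a b \<ge> f a' b) \<and> (\<forall>b'\<in>B. g a b \<ge> g a b')}"

text \<open>Maxima and minima over infinite sets are stated as attained, for the inner as well as
  for the outer optimization.\<close>

definition has_max_on :: "('a \<Rightarrow> real) \<Rightarrow> 'a set \<Rightarrow> real \<Rightarrow> bool" where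
  "has_max_on f A v \<longleftrightarrow> (\<exists>a\<in>A. f a = v) \<and> (\<forall>a\<in>A. f a \<le> v)"

definition has_min_on :: "('a \<Rightarrow> real) \<Rightarrow> 'a set \<Rightarrow> real \<Rightarrow> bool" where
  "has_min_on f A v \<longleftrightarrow> (\<exists>a\<in>A. f a = v) \<and> (\<forall>a\<in>A. v \<le> f a)"

text \<open>In the next three definitions, the first strategy set belongs to the optimizer of the
  outer problem: \<open>max a\<in>A. min b\<in>B. f a b\<close> and \<open>min a\<in>A. max b\<in>B. f a b\<close>.
  The values of the inner problem are unique on \<open>A\<close>, so the existential quantifier
  merely names them.\<close>

definition has_maximin :: "'a set \<Rightarrow> 'b set \<Rightarrow> ('a \<Rightarrow> 'b \<Rightarrow> real) \<Rightarrow> real \<Rightarrow> bool" where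
  "has_maximin A B f v \<longleftrightarrow>
     (\<exists>m. (\<forall>a\<in>A. has_min_on (f a) B (m a)) \<and> has_max_on m A v)"

definition has_minimax :: "'a set \<Rightarrow> 'b set \<Rightarrow> ('a \<Rightarrow> 'b \<Rightarrow> real) \<Rightarrow> real \<Rightarrow> bool" where
  "has_minimax A B f v \<longleftrightarrow>
     (\<exists>M. (\<forall>a\<in>A. has_max_on (f a) B (M a)) \<and> has_min_on M A v)"

definition minimaximizer :: "'a set \<Rightarrow> 'b set \<Rightarrow> ('a \<Rightarrow> 'b \<Rightarrow> real) \<Rightarrow> 'a \<Rightarrow> bool" where
  "minimaximizer A B f a \<longleftrightarrow>
     (\<exists>M. (\<forall>a'\<in>A. has_max_on (f a') B (M a')) \<and> is_arg_min M (\<lambda>a'. a' \<in> A) a)"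

end

theory Submission
  imports Defs
begin

text \<open>Sending no flow and attacking nothing each secure a payoff of zero, and each player can hold
  the other one down to zero, which settles the maximin and minimax values. For the equilibria, let
  \<open>x\<close> be a maximum flow as in Assumption 1 and \<open>C\<close> a minimum cut. Player 1 sends \<open>x\<close> with
  probability \<open>1 / p2\<close> and nothing otherwise; player 2 attacks \<open>C\<close> with probability \<open>1 - \<alpha> / p1\<close>
  and nothing otherwise. By the max-flow min-cut theorem this is an equilibrium with payoffs zero.
  Since \<open>u1 / p1 + u2 / p2\<close> is the sum of a term in the flow and a term in the attack, the game is
  strategically equivalent to a zero-sum game, so any equilibrium may be compared with this one.\<close>

section \<open>Mixed strategies\<close>

text \<open>The weights come from indifference. If the cut is spared with probability
  \<open>\<alpha> / p1\<close>, a unit of path flow earns \<open>\<alpha>\<close> in expectation, so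
  no path is profitable and the cheapest ones break even. If \<open>x\<close> is sent with
  probability \<open>1 / p2\<close>, destroying one unit of it earns 1 in expectation; as
  \<open>x\<close> respects the capacities, no attack is profitable and one on a minimum cut breaks
  even. Equivalence to a zero-sum game transfers best replies but not payoffs, because the
  equivalent payoffs differ by terms that the opponent controls. That equilibrium payoffs vanish
  takes an extra argument, and this is where p1 > \<alpha> and p2 > 1 enter strictly. The other
  obstacle is the infinity of pure flows: expectations are infinite sums, attained optima over flows
  rest on compactness, and the finiteness of the attack set keeps the exchange of expectations
  elementary.\<close>

definition mean :: "'a set \<Rightarrow> ('a \<Rightarrow> real) \<Rightarrow> ('a \<Rightarrow> real) \<Rightarrow> real" where
  "mean A \<sigma> g = (\<Sum>\<^sub>\<infinity>x\<in>A. \<sigma> x * g x)"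

lemma expected_eq_mean: "expected A B \<sigma>1 \<sigma>2 \<phi> = mean A \<sigma>1 (\<lambda>x. mean B \<sigma>2 (\<phi> x))"
  unfolding expected_def mean_def ..

text \<open>A non-summable infinite sum has the default value 0, so additivity and monotonicity of
  \<open>mean\<close> rest on this: a bound K on g gives the dominating family
  \<open>\<sigma> x * K\<close>.\<close>

lemma mixed_summable:
  assumes "\<sigma> \<in> mixed_strategies A" "bounded (g ` A)"
  shows "(\<lambda>x. \<sigma> x * g x) summable_on A"
proof -
  obtain K where K: "\<And>x. x \<in> A \<Longrightarrow> \<bar>g x\<bar> \<le> K"
    using assms(2) by (auto simp: bounded_iff)
  have "\<sigma> summable_on A" and nn: "\<And>x. x \<in> A \<Longrightarrow> 0 \<le> \<sigma> x"
    using assms(1) by (auto simp: mixed_strategies_def summable_on_def)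
  then have "(\<lambda>x. \<sigma> x * K) summable_on A"
    by (intro summable_on_cmult_left)
  then have "(\<lambda>x. norm (\<sigma> x * g x)) summable_on A"
    by (rule summable_on_comparison_test) (use K nn in \<open>auto simp: abs_mult mult_left_mono\<close>)
  then show ?thesis by (rule abs_summable_summable)
qed

lemma mean_const:
  assumes "\<sigma> \<in> mixed_strategies A"
  shows "mean A \<sigma> (\<lambda>_. v) = v"
proof -
  have "infsum \<sigma> A = 1"
    using assms by (intro infsumI) (simp add: mixed_strategies_def)
  then show ?thesis unfolding mean_def infsum_cmult_left' by simp
qed

lemma mean_mono:
  assumes "\<sigma> \<in> mixed_strategies A" "bounded (f ` A)" "bounded (g ` A)" "\<And>x. x \<in> A \<Longrightarrow> f x \<le> g x"
  shows "mean A \<sigma> f \<le> mean A \<sigma> g"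
  unfolding mean_def
  using assms by (intro infsum_mono mixed_summable) (auto simp: mixed_strategies_def PiE_iff mult_left_mono)

lemma mean_le:
  assumes "\<sigma> \<in> mixed_strategies A" "bounded (g ` A)" "\<And>x. x \<in> A \<Longrightarrow> g x \<le> v"
  shows "mean A \<sigma> g \<le> v"
  using mean_mono[OF assms(1,2), of "\<lambda>_. v"] assms(3) by (simp add: mean_const[OF assms(1)] image_constant_conv)

lemma mean_ge:
  assumes "\<sigma> \<in> mixed_strategies A" "bounded (g ` A)" "\<And>x. x \<in> A \<Longrightarrow> v \<le> g x"
  shows "v \<le> mean A \<sigma> g"
  using mean_mono[OF assms(1) _ assms(2), of "\<lambda>_. v"] assms(3) by (simp add: mean_const[OF assms(1)] image_constant_conv)

lemma mean_cong: "(\<And>x. x \<in> A \<Longrightarrow> f x = g x) \<Longrightarrow> mean A \<sigma> f = mean A \<sigma> g"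
  unfolding mean_def by (rule infsum_cong) simp

lemma mean_zero: "(\<And>x. x \<in> A \<Longrightarrow> g x = 0) \<Longrightarrow> mean A \<sigma> g = 0"
  unfolding mean_def by (simp add: infsum_0)

lemma mean_cmult: "mean A \<sigma> (\<lambda>x. k * g x) = k * mean A \<sigma> g"
  unfolding mean_def mult.left_commute[of _ k] by (rule infsum_cmult_right')

lemma mean_add:
  assumes "\<sigma> \<in> mixed_strategies A" "bounded (f ` A)" "bounded (g ` A)"
  shows "mean A \<sigma> (\<lambda>x. f x + g x) = mean A \<sigma> f + mean A \<sigma> g"
  unfolding mean_def distrib_left using assms by (intro infsum_add mixed_summable)

lemma bounded_cmult_image:
  fixes g :: "'a \<Rightarrow> real"
  assumes "bounded (g ` A)"
  shows "bounded ((\<lambda>x. k * g x) ` A)"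
  using bounded_scaling[OF assms, of k] by (simp add: image_image)

lemma bounded_sum_image:
  fixes g :: "'i \<Rightarrow> 'a \<Rightarrow> real"
  assumes "finite I" "\<And>i. i \<in> I \<Longrightarrow> bounded (g i ` A)"
  shows "bounded ((\<lambda>x. \<Sum>i\<in>I. g i x) ` A)"
  using assms by (induction I rule: finite_induct) (auto simp: image_constant_conv intro!: bounded_plus_comp)

lemma mean_sum:
  assumes "\<sigma> \<in> mixed_strategies A" "finite I" "\<And>i. i \<in> I \<Longrightarrow> bounded (g i ` A)"
  shows "mean A \<sigma> (\<lambda>x. \<Sum>i\<in>I. g i x) = (\<Sum>i\<in>I. mean A \<sigma> (g i))"
  using assms(2,3)
proof (induction I rule: finite_induct)
  case (insert i I)
  have "bounded ((\<lambda>x. \<Sum>i\<in>I. g i x) ` A)"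
    using insert by (simp add: bounded_sum_image)
  then show ?case using insert assms(1) by (simp add: mean_add)
qed (simp add: mean_def)

lemma bounded_mean:
  assumes "\<sigma> \<in> mixed_strategies B" "finite B" "\<And>y. y \<in> B \<Longrightarrow> bounded ((\<lambda>x. \<phi> x y) ` A)"
  shows "bounded ((\<lambda>x. mean B \<sigma> (\<phi> x)) ` A)"
  unfolding mean_def using assms by (simp add: bounded_sum_image bounded_cmult_image)

text \<open>For finite B the reversed order of averaging is plain linearity of
  \<open>mean A\<close>. It exhibits the payoff as the average of a function of player 2's action
  alone.\<close>

lemma expected_swap:
  assumes "\<sigma>1 \<in> mixed_strategies A" "finite B" "\<And>y. y \<in> B \<Longrightarrow> bounded ((\<lambda>x. \<phi> x y) ` A)"
  shows "expected A B \<sigma>1 \<sigma>2 \<phi> = mean B \<sigma>2 (\<lambda>y. mean A \<sigma>1 (\<lambda>x. \<phi> x y))"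
proof -
  have "expected A B \<sigma>1 \<sigma>2 \<phi> = mean A \<sigma>1 (\<lambda>x. \<Sum>y\<in>B. \<sigma>2 y * \<phi> x y)"
    unfolding expected_eq_mean using assms(2) by (intro mean_cong) (simp add: mean_def)
  also have "\<dots> = (\<Sum>y\<in>B. mean A \<sigma>1 (\<lambda>x. \<sigma>2 y * \<phi> x y))"
    using assms by (intro mean_sum bounded_cmult_image)
  also have "\<dots> = mean B \<sigma>2 (\<lambda>y. mean A \<sigma>1 (\<lambda>x. \<phi> x y))"
    unfolding mean_cmult using assms(2) by (simp add: mean_def)
  finally show ?thesis .
qed

section \<open>Pure strategies, two-point mixtures and attained optima\<close>

definition pure :: "'a set \<Rightarrow> 'a \<Rightarrow> 'a \<Rightarrow> real" where
  "pure A a = (\<lambda>x\<in>A. if x = a then 1 else 0)"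

definition mix :: "'a set \<Rightarrow> real \<Rightarrow> ('a \<Rightarrow> real) \<Rightarrow> ('a \<Rightarrow> real) \<Rightarrow> 'a \<Rightarrow> real" where
  "mix A q \<sigma> \<tau> = (\<lambda>x\<in>A. q * \<sigma> x + (1 - q) * \<tau> x)"

lemma mean_pure:
  assumes "a \<in> A"
  shows "mean A (pure A a) g = g a"
proof -
  have "mean A (pure A a) g = (\<Sum>\<^sub>\<infinity>x\<in>{a}. g x)"
    unfolding mean_def pure_def using assms by (intro infsum_cong_neutral) auto
  then show ?thesis by simp
qed

lemma pure_mixed:
  assumes "a \<in> A"
  shows "pure A a \<in> mixed_strategies A"
proof -
  have "(pure A a has_sum 1) A \<longleftrightarrow> ((\<lambda>_. 1::real) has_sum 1) {a}"
    using assms by (intro has_sum_cong_neutral) (auto simp: pure_def)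
  then show ?thesis by (auto simp: mixed_strategies_def pure_def has_sum_finite_iff)
qed

lemma mix_mixed:
  assumes "\<sigma> \<in> mixed_strategies A" "\<tau> \<in> mixed_strategies A" "0 \<le> q" "q \<le> 1"
  shows "mix A q \<sigma> \<tau> \<in> mixed_strategies A"
proof -
  have s: "(\<sigma> has_sum 1) A" "(\<tau> has_sum 1) A"
    and r: "\<And>x. x \<in> A \<Longrightarrow> 0 \<le> \<sigma> x \<and> \<sigma> x \<le> 1" "\<And>x. x \<in> A \<Longrightarrow> 0 \<le> \<tau> x \<and> \<tau> x \<le> 1"
    using assms(1,2) by (auto simp: mixed_strategies_def PiE_iff)
  have "((\<lambda>x. q * \<sigma> x + (1 - q) * \<tau> x) has_sum (q * 1 + (1 - q) * 1)) A"
    by (intro has_sum_add has_sum_cmult_right s)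
  then have "(mix A q \<sigma> \<tau> has_sum 1) A"
    unfolding mix_def by (subst has_sum_cong[where g = "\<lambda>x. q * \<sigma> x + (1 - q) * \<tau> x"]) auto
  moreover have "q * \<sigma> x + (1 - q) * \<tau> x \<le> 1" if "x \<in> A" for x
    using r[OF that] assms(3,4) by (intro convex_bound_le) auto
  ultimately show ?thesis
    using r assms(3,4) by (auto simp: mixed_strategies_def mix_def)
qed

lemma mean_mix:
  assumes "\<sigma> \<in> mixed_strategies A" "\<tau> \<in> mixed_strategies A" "bounded (g ` A)"
  shows "mean A (mix A q \<sigma> \<tau>) g = q * mean A \<sigma> g + (1 - q) * mean A \<tau> g"
proof -
  have "mean A (mix A q \<sigma> \<tau>) g = (\<Sum>\<^sub>\<infinity>x\<in>A. q * (\<sigma> x * g x) + (1 - q) * (\<tau> x * g x))"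
    unfolding mean_def mix_def by (intro infsum_cong) (simp add: algebra_simps)
  also have "\<dots> = q * mean A \<sigma> g + (1 - q) * mean A \<tau> g"
    using assms unfolding mean_def
    by (simp add: infsum_add infsum_cmult_right' summable_on_cmult_right mixed_summable)
  finally show ?thesis .
qed

text \<open>An average never exceeds the largest value and a point mass attains it, so optimal
  replies can be sought among pure actions.\<close>

lemma mean_has_max:
  assumes "bounded (g ` A)" "a \<in> A" "\<And>x. x \<in> A \<Longrightarrow> g x \<le> g a"
  shows "has_max_on (\<lambda>\<sigma>. mean A \<sigma> g) (mixed_strategies A) (g a)"
  unfolding has_max_on_def
  using assms by (auto intro!: mean_le bexI[of _ "pure A a"] mean_pure pure_mixed)

lemma mean_has_min:
  assumes "bounded (g ` A)" "a \<in> A" "\<And>x. x \<in> A \<Longrightarrow> g a \<le> g x"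
  shows "has_min_on (\<lambda>\<sigma>. mean A \<sigma> g) (mixed_strategies A) (g a)"
  unfolding has_min_on_def
  using assms by (auto intro!: mean_ge bexI[of _ "pure A a"] mean_pure pure_mixed)

text \<open>The inner optimum m need not be computed: it is bounded by v everywhere and squeezed to
  v at one guaranteeing strategy, which is all that the outer maximum requires.\<close>

lemma has_maximinI:
  assumes "\<And>a. a \<in> A \<Longrightarrow> \<exists>m. has_min_on (f a) B m"
    and "\<And>a. a \<in> A \<Longrightarrow> \<exists>b\<in>B. f a b \<le> v"
    and "a \<in> A" "\<And>b. b \<in> B \<Longrightarrow> v \<le> f a b"
  shows "has_maximin A B f v"
proof -
  obtain m where m: "\<And>a. a \<in> A \<Longrightarrow> has_min_on (f a) B (m a)"
    using assms(1) by metis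
  have le: "m a \<le> v" if "a \<in> A" for a
    using m[OF that] assms(2)[OF that] unfolding has_min_on_def by (meson order_trans)
  moreover have "v \<le> m a"
    using m[OF assms(3)] assms(4) unfolding has_min_on_def by metis
  ultimately show ?thesis
    unfolding has_maximin_def has_max_on_def using m assms(3) by (metis order_antisym)
qed

lemma has_minimaxI:
  assumes "\<And>a. a \<in> A \<Longrightarrow> \<exists>M. has_max_on (f a) B M"
    and "\<And>a. a \<in> A \<Longrightarrow> \<exists>b\<in>B. v \<le> f a b"
    and "a \<in> A" "\<And>b. b \<in> B \<Longrightarrow> f a b \<le> v"
  shows "has_minimax A B f v"
proof -
  obtain M where M: "\<And>a. a \<in> A \<Longrightarrow> has_max_on (f a) B (M a)"
    using assms(1) by metis
  have "v \<le> M a" if "a \<in> A" for a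
    using M[OF that] assms(2)[OF that] unfolding has_max_on_def by (meson order_trans)
  moreover have "M a \<le> v"
    using M[OF assms(3)] assms(4) unfolding has_max_on_def by metis
  ultimately show ?thesis
    unfolding has_minimax_def has_min_on_def using M assms(3) by (metis order_antisym)
qed

text \<open>The inner maxima are those that witness the minimax value; v bounds them from below, so
  a strategy that holds the opponent to v has the least one.\<close>

lemma minimaximizerI:
  assumes "has_minimax A B f v" "a \<in> A" "\<And>b. b \<in> B \<Longrightarrow> f a b \<le> v"
  shows "minimaximizer A B f a"
proof -
  obtain M where M: "\<And>a. a \<in> A \<Longrightarrow> has_max_on (f a) B (M a)" "\<And>a. a \<in> A \<Longrightarrow> v \<le> M a"
    using assms(1) unfolding has_minimax_def has_min_on_def by metis
  have "M a \<le> v"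
    using M(1)[OF assms(2)] assms(3) unfolding has_max_on_def by metis
  then show ?thesis
    unfolding minimaximizer_def is_arg_min_def using M assms(2) by (meson not_less order_trans)
qed

section \<open>A class of games equivalent to zero-sum games\<close>

text \<open>The actions \<open>x0\<close> and \<open>y0\<close> are the idle ones, and \<open>x1\<close> and \<open>y1\<close> are mixed with them with
  weights \<open>r\<close> and \<open>1 - q\<close>. Comparing an arbitrary equilibrium with this one shows that its payoffs
  satisfy \<open>v1 \<le> r v1\<close> and \<open>v2 \<le> (1 - q) v2\<close>, so they vanish.\<close>

locale separable_game =
  fixes A :: "'a::topological_space set" and B :: "'b set" and \<phi>1 \<phi>2 :: "'a \<Rightarrow> 'b \<Rightarrow> real"
    and h :: "'a \<Rightarrow> real" and k :: "'b \<Rightarrow> real" and k1 k2 q r :: real and x0 x1 :: 'a and y0 y1 :: 'b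
  assumes compact_A: "compact A" and finite_B: "finite B"
    and cont1: "\<And>y. y \<in> B \<Longrightarrow> continuous_on A (\<lambda>x. \<phi>1 x y)"
    and cont2: "\<And>y. y \<in> B \<Longrightarrow> continuous_on A (\<lambda>x. \<phi>2 x y)"
    and k1_pos: "0 < k1" and k2_pos: "0 < k2"
    and separable: "\<And>x y. x \<in> A \<Longrightarrow> y \<in> B \<Longrightarrow> k1 * \<phi>1 x y + k2 * \<phi>2 x y = h x + k y"
    and cont_h: "continuous_on A h"
    and actions: "x0 \<in> A" "x1 \<in> A" "y0 \<in> B" "y1 \<in> B"
    and q: "0 < q" "q < 1" and r: "0 \<le> r" "r < 1"
    and idle1: "\<And>y. y \<in> B \<Longrightarrow> \<phi>1 x0 y = 0" and idle2: "\<And>x. x \<in> A \<Longrightarrow> \<phi>2 x y0 = 0"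
    and harm1: "\<And>x. x \<in> A \<Longrightarrow> \<phi>1 x y1 \<le> 0" and harm2: "\<And>y. y \<in> B \<Longrightarrow> \<phi>2 x0 y \<le> 0"
    and hold1: "\<And>x. x \<in> A \<Longrightarrow> (1 - q) * \<phi>1 x y1 + q * \<phi>1 x y0 \<le> 0"
    and hold2: "\<And>y. y \<in> B \<Longrightarrow> r * \<phi>2 x1 y + (1 - r) * \<phi>2 x0 y \<le> 0"
    and tight1: "0 \<le> (1 - q) * \<phi>1 x1 y1 + q * \<phi>1 x1 y0"
    and tight2: "0 \<le> r * \<phi>2 x1 y1 + (1 - r) * \<phi>2 x0 y1"
begin

section \<open>Mixed extension and the reference profile\<close>

abbreviation "MA \<equiv> mixed_strategies A"
abbreviation "MB \<equiv> mixed_strategies B"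
abbreviation "E1 \<sigma>1 \<sigma>2 \<equiv> expected A B \<sigma>1 \<sigma>2 \<phi>1"
abbreviation "E2 \<sigma>1 \<sigma>2 \<equiv> expected A B \<sigma>1 \<sigma>2 \<phi>2"
text \<open>In the profile of \<open>S1\<close> and \<open>S2\<close>, neither player can gain more
  than 0 against the other by \<open>hold1\<close> and \<open>hold2\<close>, and each earns at least
  0 by \<open>tight1\<close> and \<open>tight2\<close>. Note that q is the weight of the idle action
  y0, but r that of the active action x1.\<close>

abbreviation "S1 \<equiv> mix A r (pure A x1) (pure A x0)"
abbreviation "S2 \<equiv> mix B (1 - q) (pure B y1) (pure B y0)"

lemma S1_mixed: "S1 \<in> MA" and S2_mixed: "S2 \<in> MB"
  using actions q r by (auto intro!: mix_mixed pure_mixed)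

lemma bounded1: "y \<in> B \<Longrightarrow> bounded ((\<lambda>x. \<phi>1 x y) ` A)"
  and bounded2: "y \<in> B \<Longrightarrow> bounded ((\<lambda>x. \<phi>2 x y) ` A)"
  using compact_A cont1 cont2 by (auto intro: compact_imp_bounded compact_continuous_image)

lemma bounded_h: "bounded (h ` A)"
  using compact_A cont_h by (auto intro: compact_imp_bounded compact_continuous_image)

lemma boundedB: "bounded (g ` B)" for g :: "'b \<Rightarrow> real"
  using finite_B by (simp add: finite_imp_bounded)

lemma swap1: "\<sigma>1 \<in> MA \<Longrightarrow> E1 \<sigma>1 \<sigma>2 = mean B \<sigma>2 (\<lambda>y. mean A \<sigma>1 (\<lambda>x. \<phi>1 x y))"
  by (intro expected_swap finite_B bounded1)

lemma swap2: "\<sigma>1 \<in> MA \<Longrightarrow> E2 \<sigma>1 \<sigma>2 = mean B \<sigma>2 (\<lambda>y. mean A \<sigma>1 (\<lambda>x. \<phi>2 x y))"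
  by (intro expected_swap finite_B bounded2)

lemma continuous_mean:
  assumes "\<And>y. y \<in> B \<Longrightarrow> continuous_on A (\<lambda>x. \<phi> x y)"
  shows "continuous_on A (\<lambda>x. mean B \<sigma> (\<phi> x))"
  using assms finite_B unfolding mean_def by (auto intro!: continuous_intros)

text \<open>Against a fixed \<open>\<sigma>2\<close> the payoff is the \<open>mean\<close> of a
  continuous function on a compact set, which has a best and a worst point.\<close>

lemma extrema_A:
  assumes "\<And>y. y \<in> B \<Longrightarrow> continuous_on A (\<lambda>x. \<phi> x y)"
  shows "\<exists>v. has_max_on (\<lambda>\<sigma>1. expected A B \<sigma>1 \<sigma>2 \<phi>) MA v"
    and "\<exists>v. has_min_on (\<lambda>\<sigma>1. expected A B \<sigma>1 \<sigma>2 \<phi>) MA v"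
proof -
  let ?g = "\<lambda>x. mean B \<sigma>2 (\<phi> x)"
  have c: "continuous_on A ?g" by (rule continuous_mean[OF assms])
  then have b: "bounded (?g ` A)"
    using compact_A by (auto intro: compact_imp_bounded compact_continuous_image)
  have ne: "A \<noteq> {}" using actions by auto
  obtain a where "a \<in> A" "\<forall>x\<in>A. ?g x \<le> ?g a"
    using continuous_attains_sup[OF compact_A ne c] by blast
  then have "has_max_on (\<lambda>\<sigma>1. expected A B \<sigma>1 \<sigma>2 \<phi>) MA (?g a)"
    unfolding expected_eq_mean by (intro mean_has_max[OF b]) auto
  then show "\<exists>v. has_max_on (\<lambda>\<sigma>1. expected A B \<sigma>1 \<sigma>2 \<phi>) MA v" ..
  obtain a where "a \<in> A" "\<forall>x\<in>A. ?g a \<le> ?g x"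
    using continuous_attains_inf[OF compact_A ne c] by blast
  then have "has_min_on (\<lambda>\<sigma>1. expected A B \<sigma>1 \<sigma>2 \<phi>) MA (?g a)"
    unfolding expected_eq_mean by (intro mean_has_min[OF b]) auto
  then show "\<exists>v. has_min_on (\<lambda>\<sigma>1. expected A B \<sigma>1 \<sigma>2 \<phi>) MA v" ..
qed

lemma extrema_B:
  assumes "\<sigma>1 \<in> MA" "\<And>y. y \<in> B \<Longrightarrow> continuous_on A (\<lambda>x. \<phi> x y)"
  shows "\<exists>v. has_max_on (\<lambda>\<sigma>2. expected A B \<sigma>1 \<sigma>2 \<phi>) MB v"
    and "\<exists>v. has_min_on (\<lambda>\<sigma>2. expected A B \<sigma>1 \<sigma>2 \<phi>) MB v"
proof -
  let ?g = "\<lambda>y. mean A \<sigma>1 (\<lambda>x. \<phi> x y)"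
  have b: "bounded ((\<lambda>x. \<phi> x y) ` A)" if "y \<in> B" for y
    using assms(2)[OF that] compact_A by (auto intro: compact_imp_bounded compact_continuous_image)
  have sw: "expected A B \<sigma>1 \<sigma>2 \<phi> = mean B \<sigma>2 ?g" for \<sigma>2
    by (intro expected_swap assms(1) finite_B b)
  have fin: "finite (?g ` B)" "?g ` B \<noteq> {}" using finite_B actions by auto
  obtain a where "a \<in> B" "\<forall>y\<in>B. ?g y \<le> ?g a"
    using Max_in[OF fin] Max_ge[OF fin(1)] by fastforce
  then have "has_max_on (\<lambda>\<sigma>2. expected A B \<sigma>1 \<sigma>2 \<phi>) MB (?g a)"
    unfolding sw by (intro mean_has_max[of ?g, OF boundedB]) auto
  then show "\<exists>v. has_max_on (\<lambda>\<sigma>2. expected A B \<sigma>1 \<sigma>2 \<phi>) MB v" ..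
  obtain a where "a \<in> B" "\<forall>y\<in>B. ?g a \<le> ?g y"
    using Min_in[OF fin] Min_le[OF fin(1)] by fastforce
  then have "has_min_on (\<lambda>\<sigma>2. expected A B \<sigma>1 \<sigma>2 \<phi>) MB (?g a)"
    unfolding sw by (intro mean_has_min[of ?g, OF boundedB]) auto
  then show "\<exists>v. has_min_on (\<lambda>\<sigma>2. expected A B \<sigma>1 \<sigma>2 \<phi>) MB v" ..
qed

lemma idle1_mixed: "E1 (pure A x0) \<sigma>2 = 0"
  unfolding expected_eq_mean mean_pure[OF actions(1)]
  using idle1 by (rule mean_zero)

lemma idle2_mixed: "\<sigma>1 \<in> MA \<Longrightarrow> E2 \<sigma>1 (pure B y0) = 0"
  using idle2 actions by (simp add: swap2 mean_pure mean_zero)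

lemma harm1_mixed: "\<sigma>1 \<in> MA \<Longrightarrow> E1 \<sigma>1 (pure B y1) \<le> 0"
  using harm1 bounded1 actions by (simp add: swap1 mean_pure mean_le)

lemma harm2_mixed: "\<sigma>2 \<in> MB \<Longrightarrow> E2 (pure A x0) \<sigma>2 \<le> 0"
  unfolding expected_eq_mean mean_pure[OF actions(1)]
  using harm2 boundedB by (intro mean_le) auto

text \<open>The idle part earns player 1 nothing, so mixing scales the own payoff by r. The
  opponent's payoff takes the form that \<open>hold2\<close> bounds pointwise.\<close>

lemma S1_expected:
  assumes "\<sigma>2 \<in> MB"
  shows "E1 S1 \<sigma>2 = r * E1 (pure A x1) \<sigma>2" "E2 S1 \<sigma>2 = mean B \<sigma>2 (\<lambda>y. r * \<phi>2 x1 y + (1 - r) * \<phi>2 x0 y)"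
proof -
  have "E1 S1 \<sigma>2 = r * E1 (pure A x1) \<sigma>2 + (1 - r) * E1 (pure A x0) \<sigma>2"
    unfolding expected_eq_mean
    using assms actions by (intro mean_mix pure_mixed bounded_mean finite_B bounded1)
  then show "E1 S1 \<sigma>2 = r * E1 (pure A x1) \<sigma>2" by (simp add: idle1_mixed)
  show "E2 S1 \<sigma>2 = mean B \<sigma>2 (\<lambda>y. r * \<phi>2 x1 y + (1 - r) * \<phi>2 x0 y)"
    unfolding swap2[OF S1_mixed]
    using actions by (intro mean_cong) (simp add: mean_mix[OF pure_mixed pure_mixed] bounded2 mean_pure)
qed

lemma S2_expected:
  assumes "\<sigma>1 \<in> MA"
  shows "E2 \<sigma>1 S2 = (1 - q) * E2 \<sigma>1 (pure B y1)"
    "E1 \<sigma>1 S2 = mean A \<sigma>1 (\<lambda>x. (1 - q) * \<phi>1 x y1 + q * \<phi>1 x y0)"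
proof -
  have "E2 \<sigma>1 S2 = (1 - q) * E2 \<sigma>1 (pure B y1) + (1 - (1 - q)) * E2 \<sigma>1 (pure B y0)"
    unfolding swap2[OF assms]
    using actions assms by (intro mean_mix pure_mixed boundedB)
  then show "E2 \<sigma>1 S2 = (1 - q) * E2 \<sigma>1 (pure B y1)" by (simp add: idle2_mixed assms)
  show "E1 \<sigma>1 S2 = mean A \<sigma>1 (\<lambda>x. (1 - q) * \<phi>1 x y1 + q * \<phi>1 x y0)"
    unfolding expected_eq_mean
    using actions by (simp add: mean_mix[OF pure_mixed pure_mixed boundedB] mean_pure)
qed

lemma S2_holds:
  assumes "\<sigma>1 \<in> MA"
  shows "E1 \<sigma>1 S2 \<le> 0"
proof -
  have "continuous_on A (\<lambda>x. (1 - q) * \<phi>1 x y1 + q * \<phi>1 x y0)"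
    using actions by (intro continuous_intros cont1)
  then show ?thesis
    unfolding S2_expected[OF assms] using hold1 compact_A assms
    by (intro mean_le) (auto intro: compact_imp_bounded compact_continuous_image)
qed

lemma S1_holds: "\<sigma>2 \<in> MB \<Longrightarrow> E2 S1 \<sigma>2 \<le> 0"
  using hold2 boundedB by (simp add: S1_expected mean_le)

lemma S1_S2_nonneg: "0 \<le> E1 S1 S2" "0 \<le> E2 S1 S2"
proof -
  have "E1 (pure A x1) S2 = (1 - q) * \<phi>1 x1 y1 + q * \<phi>1 x1 y0"
    using actions by (simp add: S2_expected pure_mixed mean_pure)
  then show "0 \<le> E1 S1 S2"
    using tight1 r by (simp add: S1_expected S2_mixed)
  have "E2 S1 (pure B y1) = r * \<phi>2 x1 y1 + (1 - r) * \<phi>2 x0 y1"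
    using actions by (simp add: S1_expected pure_mixed mean_pure)
  then show "0 \<le> E2 S1 S2"
    using tight2 q by (simp add: S2_expected S1_mixed)
qed

text \<open>Averaging keeps the weighted payoff sum free of interaction between
  \<open>\<sigma>1\<close> and \<open>\<sigma>2\<close>, which permits exchanging strategies between
  two profiles.\<close>

lemma expected_separable:
  assumes "\<sigma>1 \<in> MA" "\<sigma>2 \<in> MB"
  shows "k1 * E1 \<sigma>1 \<sigma>2 + k2 * E2 \<sigma>1 \<sigma>2 = mean A \<sigma>1 h + mean B \<sigma>2 k"
proof -
  have "k1 * E1 \<sigma>1 \<sigma>2 + k2 * E2 \<sigma>1 \<sigma>2
      = mean A \<sigma>1 (\<lambda>x. k1 * mean B \<sigma>2 (\<phi>1 x) + k2 * mean B \<sigma>2 (\<phi>2 x))"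
    unfolding expected_eq_mean
    using assms
    by (simp add: mean_add mean_cmult bounded_cmult_image bounded_mean finite_B bounded1 bounded2)
  also have "\<dots> = mean A \<sigma>1 (\<lambda>x. h x + mean B \<sigma>2 k)"
  proof (rule mean_cong)
    fix x assume x: "x \<in> A"
    have "k1 * mean B \<sigma>2 (\<phi>1 x) + k2 * mean B \<sigma>2 (\<phi>2 x) = mean B \<sigma>2 (\<lambda>y. k1 * \<phi>1 x y + k2 * \<phi>2 x y)"
      by (simp add: mean_add[OF assms(2) boundedB boundedB] mean_cmult)
    also have "\<dots> = mean B \<sigma>2 (\<lambda>y. h x + k y)"
      using x by (intro mean_cong separable)
    also have "\<dots> = h x + mean B \<sigma>2 k"
      by (simp add: mean_add[OF assms(2) boundedB boundedB] mean_const[OF assms(2)])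
    finally show "k1 * mean B \<sigma>2 (\<phi>1 x) + k2 * mean B \<sigma>2 (\<phi>2 x) = h x + mean B \<sigma>2 k" .
  qed
  also have "\<dots> = mean A \<sigma>1 h + mean B \<sigma>2 k"
    by (simp add: mean_add[OF assms(1) bounded_h] mean_const[OF assms(1)] image_constant_conv)
  finally show ?thesis .
qed

text \<open>Every unilateral deviation earns at most 0, and the profile itself at least 0.\<close>

lemma S1_S2_nash: "(S1, S2) \<in> nash_equilibria MA MB E1 E2"
  using S1_S2_nonneg S1_mixed S2_mixed S1_holds S2_holds
  unfolding nash_equilibria_def by (auto intro: order_trans)

lemma nash_payoff_zero:
  assumes "(\<sigma>1, \<sigma>2) \<in> nash_equilibria MA MB E1 E2"
  shows "E1 \<sigma>1 \<sigma>2 = 0" "E2 \<sigma>1 \<sigma>2 = 0"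
proof -
  have m: "\<sigma>1 \<in> MA" "\<sigma>2 \<in> MB"
    and n1: "\<And>\<sigma>. \<sigma> \<in> MA \<Longrightarrow> E1 \<sigma> \<sigma>2 \<le> E1 \<sigma>1 \<sigma>2"
    and n2: "\<And>\<sigma>. \<sigma> \<in> MB \<Longrightarrow> E2 \<sigma>1 \<sigma> \<le> E2 \<sigma>1 \<sigma>2"
    using assms by (auto simp: nash_equilibria_def)
  have z: "E1 S1 S2 = 0" "E2 S1 S2 = 0"
    using S1_S2_nonneg S1_holds[OF S2_mixed] S2_holds[OF S1_mixed] by auto
  \<comment> \<open>For a sum of one-variable terms, two profiles keep their total when they
    exchange the strategies of player 2.\<close>
  have sep: "(k1 * E1 \<sigma>1 \<sigma>2 + k2 * E2 \<sigma>1 \<sigma>2) + (k1 * E1 S1 S2 + k2 * E2 S1 S2)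
      = (k1 * E1 S1 \<sigma>2 + k2 * E2 S1 \<sigma>2) + (k1 * E1 \<sigma>1 S2 + k2 * E2 \<sigma>1 S2)"
    using m S1_mixed S2_mixed by (simp add: expected_separable)
  have d: "0 \<le> k1 * (E1 \<sigma>1 \<sigma>2 - E1 S1 \<sigma>2)" "0 \<le> k2 * (E2 \<sigma>1 \<sigma>2 - E2 \<sigma>1 S2)"
    "k1 * E1 \<sigma>1 S2 \<le> 0" "k2 * E2 S1 \<sigma>2 \<le> 0"
    using n1[OF S1_mixed] n2[OF S2_mixed] S2_holds[OF m(1)] S1_holds[OF m(2)] k1_pos k2_pos
    by (auto simp: mult_le_0_iff)
  \<comment> \<open>By \<open>sep\<close> and \<open>z\<close>, the two nonnegative losses from
    deviating add up to the sum of the two nonpositive terms in \<open>d\<close>, so all four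
    vanish.\<close>
  have "k1 * (E1 \<sigma>1 \<sigma>2 - E1 S1 \<sigma>2) = 0" "k2 * (E2 \<sigma>1 \<sigma>2 - E2 \<sigma>1 S2) = 0"
    using sep d unfolding z right_diff_distrib by linarith+
  then have eq: "E1 \<sigma>1 \<sigma>2 = r * E1 (pure A x1) \<sigma>2" "E2 \<sigma>1 \<sigma>2 = (1 - q) * E2 \<sigma>1 (pure B y1)"
    using k1_pos k2_pos m by (auto simp: S1_expected S2_expected)
  have nn: "0 \<le> E1 \<sigma>1 \<sigma>2" "0 \<le> E2 \<sigma>1 \<sigma>2"
    using n1[OF pure_mixed[OF actions(1)]] n2[OF pure_mixed[OF actions(3)]]
    by (auto simp: idle1_mixed idle2_mixed m)
  \<comment> \<open>The action x1 played surely is also a reply to \<open>\<sigma>2\<close>, hence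
    earns at most the equilibrium payoff.\<close>
  have "E1 \<sigma>1 \<sigma>2 \<le> r * E1 \<sigma>1 \<sigma>2"
    using mult_left_mono[OF n1[OF pure_mixed[OF actions(2)]] r(1)] eq(1) by simp
  then have "(1 - r) * E1 \<sigma>1 \<sigma>2 \<le> 0" by (simp add: algebra_simps)
  then show "E1 \<sigma>1 \<sigma>2 = 0" using nn r by (simp add: mult_le_0_iff)
  have "E2 \<sigma>1 \<sigma>2 \<le> (1 - q) * E2 \<sigma>1 \<sigma>2"
    using mult_left_mono[OF n2[OF pure_mixed[OF actions(4)]], of "1 - q"] q eq(2) by simp
  then have "q * E2 \<sigma>1 \<sigma>2 \<le> 0" by (simp add: algebra_simps)
  then show "E2 \<sigma>1 \<sigma>2 = 0" using nn q by (simp add: mult_le_0_iff)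
qed

section \<open>Values of the game and minimaximizers\<close>

lemma maximin1: "has_maximin MA MB E1 0"
proof (rule has_maximinI)
  show "\<exists>m. has_min_on (E1 \<sigma>1) MB m" if "\<sigma>1 \<in> MA" for \<sigma>1
    using extrema_B(2)[of _ \<phi>1, OF that cont1] .
  show "\<exists>\<sigma>2\<in>MB. E1 \<sigma>1 \<sigma>2 \<le> 0" if "\<sigma>1 \<in> MA" for \<sigma>1
    using harm1_mixed[OF that] pure_mixed[OF actions(4)] ..
  show "pure A x0 \<in> MA" by (rule pure_mixed[OF actions(1)])
qed (simp add: idle1_mixed)

lemma minimax1: "has_minimax MB MA (\<lambda>\<sigma>2 \<sigma>1. E1 \<sigma>1 \<sigma>2) 0"
proof (rule has_minimaxI)
  show "\<exists>M. has_max_on (\<lambda>\<sigma>1. E1 \<sigma>1 \<sigma>2) MA M" for \<sigma>2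
    using extrema_A(1)[of \<phi>1, OF cont1] .
  show "\<exists>\<sigma>1\<in>MA. 0 \<le> E1 \<sigma>1 \<sigma>2" for \<sigma>2
    using pure_mixed[OF actions(1)] idle1_mixed by (metis order_refl)
qed (rule S2_mixed, rule S2_holds)

lemma maximin2: "has_maximin MB MA (\<lambda>\<sigma>2 \<sigma>1. E2 \<sigma>1 \<sigma>2) 0"
proof (rule has_maximinI)
  show "\<exists>m. has_min_on (\<lambda>\<sigma>1. E2 \<sigma>1 \<sigma>2) MA m" for \<sigma>2
    using extrema_A(2)[of \<phi>2, OF cont2] .
  show "\<exists>\<sigma>1\<in>MA. E2 \<sigma>1 \<sigma>2 \<le> 0" if "\<sigma>2 \<in> MB" for \<sigma>2
    using harm2_mixed[OF that] pure_mixed[OF actions(1)] ..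
  show "pure B y0 \<in> MB" by (rule pure_mixed[OF actions(3)])
qed (simp add: idle2_mixed)

lemma minimax2: "has_minimax MA MB E2 0"
proof (rule has_minimaxI)
  show "\<exists>M. has_max_on (E2 \<sigma>1) MB M" if "\<sigma>1 \<in> MA" for \<sigma>1
    using extrema_B(1)[of _ \<phi>2, OF that cont2] .
  show "\<exists>\<sigma>2\<in>MB. 0 \<le> E2 \<sigma>1 \<sigma>2" if "\<sigma>1 \<in> MA" for \<sigma>1
    using pure_mixed[OF actions(3)] idle2_mixed[OF that] by (metis order_refl)
  show "pure A x0 \<in> MA" by (rule pure_mixed[OF actions(1)])
qed (rule harm2_mixed)

text \<open>Equality, beyond inclusion, needs some equilibrium to exist; the reference profile
  supplies it.\<close>

lemma nash_payoffs: "{(E1 \<sigma>1 \<sigma>2, E2 \<sigma>1 \<sigma>2) | \<sigma>1 \<sigma>2. (\<sigma>1, \<sigma>2) \<in> nash_equilibria MA MB E1 E2} = {(0, 0)}"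
  (is "?P = _")
proof
  show "?P \<subseteq> {(0, 0)}" using nash_payoff_zero by blast
  have "(E1 S1 S2, E2 S1 S2) \<in> ?P" using S1_S2_nash by blast
  then show "{(0, 0)} \<subseteq> ?P" using nash_payoff_zero[OF S1_S2_nash] by simp
qed

text \<open>With equilibrium payoffs 0, the best-reply inequalities say that the opponent earns at
  most 0 against each equilibrium strategy, and 0 is the minimax value.\<close>

lemma nash_minimaximizer:
  assumes "(\<sigma>1, \<sigma>2) \<in> nash_equilibria MA MB E1 E2"
  shows "minimaximizer MA MB E2 \<sigma>1" "minimaximizer MB MA (\<lambda>\<sigma>2 \<sigma>1. E1 \<sigma>1 \<sigma>2) \<sigma>2"
proof -
  have m: "\<sigma>1 \<in> MA" "\<sigma>2 \<in> MB" "\<And>\<sigma>. \<sigma> \<in> MA \<Longrightarrow> E1 \<sigma> \<sigma>2 \<le> 0" "\<And>\<sigma>. \<sigma> \<in> MB \<Longrightarrow> E2 \<sigma>1 \<sigma> \<le> 0"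
    using assms nash_payoff_zero[OF assms] by (auto simp: nash_equilibria_def)
  show "minimaximizer MA MB E2 \<sigma>1"
    by (rule minimaximizerI[OF minimax2 m(1)]) (rule m(4))
  show "minimaximizer MB MA (\<lambda>\<sigma>2 \<sigma>1. E1 \<sigma>1 \<sigma>2) \<sigma>2"
    by (rule minimaximizerI[OF minimax1 m(2)]) (rule m(3))
qed

end

section \<open>Maximum flows and minimum cuts\<close>

text \<open>Double counting of incidences between arcs and routes; w is later a potential
  difference, a unit cost or an attack.\<close>

lemma sum_route_swap:
  fixes x :: "'e set \<Rightarrow> real"
  assumes "finite E" "S \<subseteq> Pow E"
  shows "(\<Sum>e\<in>E. (\<Sum>l\<in>{l \<in> S. e \<in> l}. x l) * w e) = (\<Sum>l\<in>S. x l * (\<Sum>e\<in>l. w e))"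
proof -
  have fin: "finite S" using assms finite_subset by blast
  have "(\<Sum>e\<in>E. (\<Sum>l\<in>{l \<in> S. e \<in> l}. x l) * w e) = (\<Sum>e\<in>E. \<Sum>l\<in>{l \<in> S. e \<in> l}. x l * w e)"
    by (simp add: sum_distrib_right)
  also have "\<dots> = (\<Sum>l\<in>S. \<Sum>e\<in>{e \<in> E. e \<in> l}. x l * w e)"
    by (rule sum.swap_restrict[OF assms(1) fin])
  also have "\<dots> = (\<Sum>l\<in>S. x l * (\<Sum>e\<in>l. w e))"
  proof (rule sum.cong[OF refl])
    fix l assume "l \<in> S"
    then have "{e \<in> E. e \<in> l} = l" using assms(2) by auto
    then show "(\<Sum>e\<in>{e \<in> E. e \<in> l}. x l * w e) = x l * (\<Sum>e\<in>l. w e)"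
      by (simp add: sum_distrib_left)
  qed
  finally show ?thesis .
qed

lemma pcas_telescope:
  fixes \<phi> :: "'v \<Rightarrow> real"
  assumes "pcas u p v"
  shows "(\<Sum>e\<leftarrow>p. \<phi> (fst e) - \<phi> (snd e)) = \<phi> u - \<phi> v"
  using assms by (induction p arbitrary: u) auto

context flow_network
begin

lemma st_path_subset: "l \<in> st_paths G s t \<Longrightarrow> l \<subseteq> parcs G"
  by (auto simp: st_paths_def apath_def awalk_def)

lemma loop_subset: "l \<in> loops G \<Longrightarrow> l \<subseteq> parcs G"
  by (auto simp: loops_def cycle_def awalk_def)

lemma routes_subset: "routes G s t \<subseteq> Pow (parcs G)"
  using st_path_subset loop_subset by (auto simp: routes_def)

lemma finite_parcs: "finite (parcs G)"
  by (rule pair_finite_arcs)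

lemma finite_routes: "finite (routes G s t)"
  using routes_subset finite_parcs by (meson finite_Pow_iff finite_subset)

lemma finite_st_paths: "finite (st_paths G s t)"
  using finite_routes by (simp add: routes_def)

text \<open>Routes are arc sets, whereas telescoping happens along arc lists; a simple path repeats
  no vertex, hence no arc, and the two sums agree.\<close>

lemma st_path_telescope:
  fixes \<phi> :: "'v \<Rightarrow> real"
  assumes "l \<in> st_paths G s t"
  shows "(\<Sum>e\<in>l. \<phi> (fst e) - \<phi> (snd e)) = \<phi> s - \<phi> t"
proof -
  obtain p where p: "l = set p" "apath s p t"
    using assms by (auto simp: st_paths_def)
  then have "distinct (pawalk_verts s p)" "pcas s p t"
    by (auto simp: apath_def awalk_def)
  then have "distinct p"
    by (auto simp: awalk_verts_conv distinct_map split: if_splits)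
  then show ?thesis
    using pcas_telescope[OF \<open>pcas s p t\<close>, of \<phi>] p(1) by (simp add: sum_list_distinct_conv_sum_set)
qed

text \<open>With the indicator of R as potential the telescoping sum is 1, while an arc contributes
  positively only when it leaves R.\<close>

lemma st_path_crosses:
  assumes "l \<in> st_paths G s t" "s \<in> R" "t \<notin> R"
  shows "\<exists>e\<in>l. fst e \<in> R \<and> snd e \<notin> R"
proof (rule ccontr)
  assume no: "\<not> ?thesis"
  have "(\<Sum>e\<in>l. indicat_real R (fst e) - indicat_real R (snd e)) \<le> 0"
    using no by (intro sum_nonpos) (auto simp: indicator_def)
  then show False
    using st_path_telescope[OF assms(1), of "indicat_real R"] assms(2,3) by simp
qed

lemma st_path_nonempty: "l \<in> st_paths G s t \<Longrightarrow> l \<noteq> {}"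
  using st_path_crosses[of l "{s}"] dest_neq_source by auto

lemma route_cost_nonneg:
  assumes "l \<in> routes G s t"
  shows "0 \<le> route_cost b l"
proof -
  have "l \<subseteq> parcs G" using assms routes_subset by auto
  then show ?thesis
    unfolding route_cost_def by (intro sum_nonneg less_imp_le[OF unit_cost_pos]) auto
qed

lemma route_cost_pos: "l \<in> st_paths G s t \<Longrightarrow> 0 < route_cost b l"
  unfolding route_cost_def
  using st_path_subset[of l] st_path_nonempty[of l] unit_cost_pos finite_parcs
  by (intro sum_pos) (auto intro: finite_subset)

lemma min_path_cost_le: "l \<in> st_paths G s t \<Longrightarrow> min_path_cost G s t b \<le> route_cost b l"
  unfolding min_path_cost_def using finite_st_paths by simp

lemma min_path_cost_pos: "0 < min_path_cost G s t b"
  unfolding min_path_cost_def using finite_st_paths st_path_exists route_cost_pos by simp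

text \<open>Conservation at the inner vertices is expressed by testing against arbitrary potentials.\<close>

definition carries :: "('v \<times> 'v \<Rightarrow> real) \<Rightarrow> real \<Rightarrow> bool" where
  "carries f v \<longleftrightarrow>
     (\<forall>\<phi> :: 'v \<Rightarrow> real. (\<Sum>e\<in>parcs G. f e * (\<phi> (fst e) - \<phi> (snd e))) = v * (\<phi> s - \<phi> t))"

text \<open>Loops are left out: they add nothing to \<open>flow_value\<close>, and the cut argument
  runs on the path part alone.\<close>

definition path_edge_flow :: "'v flow \<Rightarrow> 'v \<times> 'v \<Rightarrow> real" where
  "path_edge_flow x e = (\<Sum>l\<in>{l \<in> st_paths G s t. e \<in> l}. x l)"

lemma path_edge_flow_carries: "carries (path_edge_flow x) (flow_value G s t x)"
proof -
  have "st_paths G s t \<subseteq> Pow (parcs G)" using st_path_subset by auto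
  then show ?thesis
    unfolding carries_def path_edge_flow_def flow_value_def sum_distrib_right[of _ "st_paths G s t"]
    by (subst sum_route_swap[OF finite_parcs]) (simp_all add: st_path_telescope)
qed

section \<open>Decomposition of edge flows into path flows\<close>

lemma positive_walk:
  assumes "(s, u) \<in> {e \<in> parcs G. P e}\<^sup>*"
  shows "\<exists>p. awalk s p u \<and> (\<forall>e\<in>set p. P e)"
  using assms
proof (induction rule: rtrancl_induct)
  case base
  then show ?case using source_in_verts by (intro exI[of _ "[]"]) (simp add: awalk_Nil_iff)
next
  case (step u w)
  then obtain p where p: "awalk s p u" "\<forall>e\<in>set p. P e" by blast
  have "awalk u [(u, w)] w"
    using step(2) by (auto simp: awalk_def intro: in_arcsD1)
  then show ?case
    using p step(2) by (intro exI[of _ "p @ [(u, w)]"]) auto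
qed

text \<open>No arc with positive flow leaves the set R of vertices reachable along such arcs, so the
  net flow out of R is at most 0; were t outside R, it would be v > 0.\<close>

lemma carries_positive_path:
  assumes "carries f v" "0 < v" "\<And>e. e \<in> parcs G \<Longrightarrow> 0 \<le> f e"
  shows "\<exists>l\<in>st_paths G s t. \<forall>e\<in>l. 0 < f e"
proof -
  define R where "R = {e \<in> parcs G. 0 < f e}\<^sup>* `` {s}"
  have s: "s \<in> R" by (simp add: R_def)
  have "f e * (indicat_real R (fst e) - indicat_real R (snd e)) \<le> 0" if "e \<in> parcs G" for e
  proof (cases "fst e \<in> R \<and> snd e \<notin> R")
    case True
    then have "\<not> 0 < f e"
      using that unfolding R_def by (cases e) (auto intro: rtrancl_into_rtrancl)
    then show ?thesis using True assms(3)[OF that] by simp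
  next
    case False
    then show ?thesis using assms(3)[OF that] by (auto simp: indicator_def)
  qed
  then have "(\<Sum>e\<in>parcs G. f e * (indicat_real R (fst e) - indicat_real R (snd e))) \<le> 0"
    by (rule sum_nonpos)
  then have "v * (1 - indicat_real R t) \<le> 0"
    using assms(1) s unfolding carries_def by simp
  then have "t \<in> R" using assms(2) by (cases "t \<in> R") auto
  then obtain p where p: "awalk s p t" "\<forall>e\<in>set p. 0 < f e"
    using positive_walk[of t "\<lambda>e. 0 < f e"] unfolding R_def by auto
  have "set (awalk_to_apath p) \<in> st_paths G s t"
    using apath_awalk_to_apath[OF p(1)] by (auto simp: st_paths_def)
  then show ?thesis using p(2) awalk_to_apath_subset[OF p(1)] by blast
qed

text \<open>Induction on the number of arcs with positive flow, peeling off one path at a time. The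
  bound by f is only an inequality because a circulation may be left over at the end.\<close>

lemma flow_decomposition:
  assumes "carries f v" "0 \<le> v" "\<And>e. e \<in> parcs G \<Longrightarrow> 0 \<le> f e"
  shows "\<exists>x. (\<forall>l. 0 \<le> x l) \<and> flow_value G s t x = v \<and> (\<forall>e\<in>parcs G. path_edge_flow x e \<le> f e)"
  using assms
proof (induction "card {e \<in> parcs G. 0 < f e}" arbitrary: f v rule: less_induct)
  case less
  show ?case
  proof (cases "v = 0")
    case True
    then show ?thesis
      using less.prems(3) by (intro exI[of _ "\<lambda>_. 0"]) (simp add: flow_value_def path_edge_flow_def)
  next
    case False
    then obtain l where l: "l \<in> st_paths G s t" "\<And>e. e \<in> l \<Longrightarrow> 0 < f e"
      using carries_positive_path[of f v] less.prems by fastforce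
    have fin: "finite l" and ne: "l \<noteq> {}" and sub: "l \<subseteq> parcs G"
      using st_path_subset[OF l(1)] finite_parcs st_path_nonempty[OF l(1)] by (auto intro: finite_subset)
    \<comment> \<open>The bottleneck of the path, capped by v so that the remaining value is not
      negative.\<close>
    define m where "m = min v (Min (f ` l))"
    have m: "0 < m" "m \<le> v" and mf: "\<And>e. e \<in> l \<Longrightarrow> m \<le> f e"
      using l(2) fin ne False less.prems(2) by (auto simp: m_def min_le_iff_disj)
    define one where "one = (\<lambda>l'. if l' = l then m else 0)"
    have one_value: "flow_value G s t one = m"
      using l(1) finite_st_paths by (simp add: flow_value_def one_def)
    have one_edge: "path_edge_flow one e = (if e \<in> l then m else 0)" for e
      using l(1) finite_st_paths by (simp add: path_edge_flow_def one_def)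
    have add_value: "flow_value G s t (\<lambda>l. y l + one l) = flow_value G s t y + m" for y
      using one_value by (simp add: flow_value_def sum.distrib)
    have add_edge: "path_edge_flow (\<lambda>l. y l + one l) e = path_edge_flow y e + (if e \<in> l then m else 0)" for y e
      using one_edge[of e] by (simp add: path_edge_flow_def sum.distrib)
    show ?thesis
    proof (cases "m = v")
      case True
      then show ?thesis
        using m mf less.prems(3) one_value one_edge by (intro exI[of _ one]) (auto simp: one_def)
    next
      case neq: False
      define f' where "f' e = f e - path_edge_flow one e" for e
      have f'_nonneg: "0 \<le> f' e" if "e \<in> parcs G" for e
        using that mf less.prems(3) by (simp add: f'_def one_edge)
      have "carries f' (v - m)"
        using less.prems(1) path_edge_flow_carries[of one]
        unfolding carries_def f'_def one_value by (simp add: left_diff_distrib sum_subtractf)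
      \<comment> \<open>When the cap is inactive, some arc of l loses all its flow and the induction
        measure drops.\<close>
      have "m = Min (f ` l)" using neq by (simp add: m_def min_def split: if_splits)
      then have "m \<in> f ` l" using Min_in[of "f ` l"] fin ne by simp
      then obtain e where e: "e \<in> l" "f e = m" by auto
      have "{e \<in> parcs G. 0 < f' e} \<subset> {e \<in> parcs G. 0 < f e}"
      proof
        show "{e \<in> parcs G. 0 < f' e} \<subseteq> {e \<in> parcs G. 0 < f e}"
          using m(1) by (auto simp: f'_def one_edge split: if_splits)
        have "e \<in> parcs G" "\<not> 0 < f' e" "0 < f e"
          using e sub m by (auto simp: f'_def one_edge)
        then show "{e \<in> parcs G. 0 < f' e} \<noteq> {e \<in> parcs G. 0 < f e}" by blast
      qed
      then have "card {e \<in> parcs G. 0 < f' e} < card {e \<in> parcs G. 0 < f e}"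
        using finite_parcs by (intro psubset_card_mono) auto
      from less.hyps[OF this \<open>carries f' (v - m)\<close>] f'_nonneg m
      obtain y where y: "\<forall>l. 0 \<le> y l" "flow_value G s t y = v - m"
        "\<And>e. e \<in> parcs G \<Longrightarrow> path_edge_flow y e \<le> f' e" by auto
      show ?thesis
      proof (intro exI[of _ "\<lambda>l. y l + one l"] conjI allI ballI)
        show "0 \<le> y l' + one l'" for l' using y(1) m by (simp add: one_def)
        show "flow_value G s t (\<lambda>l. y l + one l) = v" using y(2) by (simp add: add_value)
        show "path_edge_flow (\<lambda>l. y l + one l) e \<le> f e" if "e \<in> parcs G" for e
          using y(3)[OF that] by (simp add: add_edge f'_def one_edge)
      qed
    qed
  qed
qed

section \<open>Residual graph, augmentation and minimum cuts\<close>

definition residual :: "('v \<times> 'v \<Rightarrow> real) \<Rightarrow> ('v \<times> 'v) set" where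
  "residual f = {e \<in> parcs G. f e < c e} \<union> {e \<in> parcs G. 0 < f e}\<inverse>"

text \<open>The directions in which \<open>f\<close> can be varied form a cone, so residual walks need not be made
  simple before they are turned into such directions.\<close>

lemma residual_direction:
  assumes "(s, u) \<in> (residual f)\<^sup>*"
  shows "\<exists>d. (\<forall>e\<in>parcs G. (0 < d e \<longrightarrow> f e < c e) \<and> (d e < 0 \<longrightarrow> 0 < f e)) \<and>
    (\<forall>\<phi> :: 'v \<Rightarrow> real. (\<Sum>e\<in>parcs G. d e * (\<phi> (fst e) - \<phi> (snd e))) = \<phi> s - \<phi> u)"
  using assms
proof (induction rule: rtrancl_induct)
  case base
  show ?case by (intro exI[of _ "\<lambda>_. 0"]) simp
next
  case (step u w)
  then obtain d where d: "\<And>e. e \<in> parcs G \<Longrightarrow> (0 < d e \<longrightarrow> f e < c e) \<and> (d e < 0 \<longrightarrow> 0 < f e)"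
    "\<And>\<phi> :: 'v \<Rightarrow> real. (\<Sum>e\<in>parcs G. d e * (\<phi> (fst e) - \<phi> (snd e))) = \<phi> s - \<phi> u"
    by blast
  \<comment> \<open>The direction is changed on a single arc: r is 1 for a forward arc and -1 for an
    arc traversed backwards.\<close>
  have unit: "(\<Sum>e\<in>parcs G. (d e + (if e = a then r else 0)) * (\<phi> (fst e) - \<phi> (snd e)))
      = \<phi> s - \<phi> u + r * (\<phi> (fst a) - \<phi> (snd a))" if "a \<in> parcs G" for a r and \<phi> :: "'v \<Rightarrow> real"
    using that finite_parcs
    by (simp add: distrib_right sum.distrib d(2) if_distrib[of "\<lambda>r. r * _"] cong: if_cong)
  consider "(u, w) \<in> parcs G" "f (u, w) < c (u, w)" | "(w, u) \<in> parcs G" "0 < f (w, u)"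
    using step(2) by (auto simp: residual_def)
  then show ?case
  proof cases
    case 1
    then show ?thesis
      using d(1) unit[OF 1(1), of 1]
      by (intro exI[of _ "\<lambda>e. d e + (if e = (u, w) then 1 else 0)"]) auto
  next
    case 2
    then show ?thesis
      using d(1) unit[OF 2(1), of "-1"]
      by (intro exI[of _ "\<lambda>e. d e + (if e = (w, u) then - 1 else 0)"]) auto
  qed
qed

lemma path_edge_flow_le:
  assumes "x \<in> feasible_flows G s t c" "e \<in> parcs G"
  shows "0 \<le> path_edge_flow x e" "path_edge_flow x e \<le> edge_flow G s t x e" "path_edge_flow x e \<le> c e"
proof -
  have nn: "\<And>l. l \<in> routes G s t \<Longrightarrow> 0 \<le> x l" and le: "edge_flow G s t x e \<le> c e"
    using assms by (auto simp: feasible_flows_def PiE_iff)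
  show "0 \<le> path_edge_flow x e"
    unfolding path_edge_flow_def using nn by (intro sum_nonneg) (auto simp: routes_def)
  show "path_edge_flow x e \<le> edge_flow G s t x e"
    unfolding path_edge_flow_def edge_flow_def
    using nn finite_routes by (intro sum_mono2) (auto simp: routes_def)
  then show "path_edge_flow x e \<le> c e" using le by simp
qed

text \<open>This serves both to turn a decomposition into a strategy and to strip the loops from a
  given flow.\<close>

lemma path_flow_feasible:
  assumes "\<And>l. l \<in> st_paths G s t \<Longrightarrow> 0 \<le> x l" "\<And>e. e \<in> parcs G \<Longrightarrow> path_edge_flow x e \<le> c e"
  defines "y \<equiv> (\<lambda>l\<in>routes G s t. if l \<in> st_paths G s t then x l else 0)"
  shows "y \<in> feasible_flows G s t c" "flow_value G s t y = flow_value G s t x"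
proof -
  have "edge_flow G s t y e = path_edge_flow x e" for e
  proof -
    have "edge_flow G s t y e = (\<Sum>l\<in>{l \<in> st_paths G s t. e \<in> l}. y l)"
      unfolding edge_flow_def using finite_routes
      by (intro sum.mono_neutral_right) (auto simp: routes_def y_def)
    also have "\<dots> = path_edge_flow x e"
      unfolding path_edge_flow_def by (intro sum.cong) (auto simp: routes_def y_def)
    finally show ?thesis .
  qed
  then show "y \<in> feasible_flows G s t c"
    using assms(1,2) by (auto simp: feasible_flows_def y_def)
  show "flow_value G s t y = flow_value G s t x"
    unfolding flow_value_def by (intro sum.cong) (auto simp: routes_def y_def)
qed

text \<open>A small step \<open>\<epsilon>\<close> along a residual direction stays within the
  bounds and carries \<open>v + \<epsilon>\<close>; decomposing the result gives a better feasible
  flow.\<close>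

lemma augment:
  assumes f: "\<And>e. e \<in> parcs G \<Longrightarrow> 0 \<le> f e \<and> f e \<le> c e" "carries f v" "0 \<le> v"
    and "(s, t) \<in> (residual f)\<^sup>*"
  shows "\<exists>y\<in>feasible_flows G s t c. v < flow_value G s t y"
proof -
  obtain d where d: "\<And>e. e \<in> parcs G \<Longrightarrow> (0 < d e \<longrightarrow> f e < c e) \<and> (d e < 0 \<longrightarrow> 0 < f e)"
    "\<And>\<phi> :: 'v \<Rightarrow> real. (\<Sum>e\<in>parcs G. d e * (\<phi> (fst e) - \<phi> (snd e))) = \<phi> s - \<phi> t"
    using residual_direction[OF assms(4)] by blast
  have "\<forall>e\<in>parcs G. \<forall>\<^sub>F \<epsilon> in at_right 0. 0 \<le> f e + \<epsilon> * d e \<and> f e + \<epsilon> * d e \<le> c e"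
  proof
    fix e assume e: "e \<in> parcs G"
    have pos: "\<forall>\<^sub>F \<epsilon> in at_right (0::real). 0 < \<epsilon>" by (rule eventually_at_right_less)
    have lim: "((\<lambda>\<epsilon>. f e + \<epsilon> * d e) \<longlongrightarrow> f e) (at_right 0)"
      by (auto intro!: tendsto_eq_intros)
    \<comment> \<open>Slack exists only on the side towards which \<open>d e\<close> moves; the
      opposite bound is inherited from f.\<close>
    consider "d e = 0" | "0 < d e" | "d e < 0" by linarith
    then show "\<forall>\<^sub>F \<epsilon> in at_right 0. 0 \<le> f e + \<epsilon> * d e \<and> f e + \<epsilon> * d e \<le> c e"
    proof cases
      case 1
      then show ?thesis using f(1)[OF e] by simp
    next
      case 2
      have "\<forall>\<^sub>F \<epsilon> in at_right 0. f e + \<epsilon> * d e < c e"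
        using order_tendstoD(2)[OF lim] d(1)[OF e] 2 by blast
      with pos show ?thesis
        by eventually_elim (use 2 f(1)[OF e] in auto)
    next
      case 3
      have "\<forall>\<^sub>F \<epsilon> in at_right 0. 0 < f e + \<epsilon> * d e"
        using order_tendstoD(1)[OF lim] d(1)[OF e] 3 by blast
      with pos show ?thesis
      proof eventually_elim
        case (elim \<epsilon>)
        then have "\<epsilon> * d e \<le> 0" using 3 by (simp add: mult_le_0_iff)
        then show ?case using elim f(1)[OF e] by simp
      qed
    qed
  qed
  then have "\<forall>\<^sub>F \<epsilon> in at_right 0. \<forall>e\<in>parcs G. 0 \<le> f e + \<epsilon> * d e \<and> f e + \<epsilon> * d e \<le> c e"
    by (rule eventually_ball_finite[OF finite_parcs])
  moreover have "\<forall>\<^sub>F \<epsilon> in at_right (0::real). 0 < \<epsilon>" by (rule eventually_at_right_less)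
  ultimately have "\<exists>\<epsilon>>0. \<forall>e\<in>parcs G. 0 \<le> f e + \<epsilon> * d e \<and> f e + \<epsilon> * d e \<le> c e"
    using eventually_happens[OF eventually_conj] trivial_limit_at_right_real by blast
  then obtain \<epsilon> where \<epsilon>: "0 < \<epsilon>" "\<And>e. e \<in> parcs G \<Longrightarrow> 0 \<le> f e + \<epsilon> * d e \<and> f e + \<epsilon> * d e \<le> c e"
    by blast
  have "carries (\<lambda>e. f e + \<epsilon> * d e) (v + \<epsilon>)"
    unfolding carries_def
  proof
    fix \<phi> :: "'v \<Rightarrow> real"
    have "(\<Sum>e\<in>parcs G. (f e + \<epsilon> * d e) * (\<phi> (fst e) - \<phi> (snd e)))
        = (\<Sum>e\<in>parcs G. f e * (\<phi> (fst e) - \<phi> (snd e))) + \<epsilon> * (\<Sum>e\<in>parcs G. d e * (\<phi> (fst e) - \<phi> (snd e)))"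
      by (simp add: distrib_right sum.distrib sum_distrib_left mult.assoc)
    also have "\<dots> = (v + \<epsilon>) * (\<phi> s - \<phi> t)"
      using f(2) unfolding carries_def d(2) by (simp add: distrib_right)
    finally show "(\<Sum>e\<in>parcs G. (f e + \<epsilon> * d e) * (\<phi> (fst e) - \<phi> (snd e))) = (v + \<epsilon>) * (\<phi> s - \<phi> t)" .
  qed
  then obtain x where x: "\<forall>l. 0 \<le> x l" "flow_value G s t x = v + \<epsilon>"
    "\<forall>e\<in>parcs G. path_edge_flow x e \<le> f e + \<epsilon> * d e"
    using flow_decomposition[of "\<lambda>e. f e + \<epsilon> * d e" "v + \<epsilon>"] \<epsilon> f(3) by auto
  then have "\<And>e. e \<in> parcs G \<Longrightarrow> path_edge_flow x e \<le> c e"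
    using \<epsilon>(2) by (meson order_trans)
  with path_flow_feasible[of x] x \<epsilon>(1) show ?thesis by force
qed

text \<open>Let R be the set of vertices reachable in the residual graph. Arcs leaving R are
  saturated and arcs entering it are empty, so testing conservation with the indicator of R equates
  value and cut capacity.\<close>

lemma max_flow_min_cut:
  assumes x: "x \<in> feasible_flows G s t c"
    and max: "\<And>y. y \<in> feasible_flows G s t c \<Longrightarrow> flow_value G s t y \<le> flow_value G s t x"
  shows "\<exists>C\<subseteq>parcs G. (\<forall>l\<in>st_paths G s t. l \<inter> C \<noteq> {}) \<and> (\<Sum>e\<in>C. c e) = flow_value G s t x"
proof -
  define f where "f = path_edge_flow x"
  have f: "0 \<le> f e" "f e \<le> c e" if "e \<in> parcs G" for e
    using path_edge_flow_le[OF x that] by (auto simp: f_def)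
  have f_carries: "carries f (flow_value G s t x)"
    by (simp add: f_def path_edge_flow_carries)
  have "0 \<le> flow_value G s t x"
    using x unfolding flow_value_def by (intro sum_nonneg) (auto simp: feasible_flows_def routes_def PiE_iff)
  define R where "R = (residual f)\<^sup>* `` {s}"
  have sR: "s \<in> R" by (simp add: R_def)
  \<comment> \<open>A residual walk to t would contradict the maximality of x.\<close>
  have tR: "t \<notin> R"
    using augment[OF _ f_carries \<open>0 \<le> flow_value G s t x\<close>] f max unfolding R_def by fastforce
  have closed: "w \<in> R" if "u \<in> R" "(u, w) \<in> residual f" for u w
    using that unfolding R_def by (auto intro: rtrancl_into_rtrancl)
  define C where "C = {e \<in> parcs G. fst e \<in> R \<and> snd e \<notin> R}"
  have "l \<inter> C \<noteq> {}" if "l \<in> st_paths G s t" for l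
    using st_path_crosses[OF that sR tR] st_path_subset[OF that] by (auto simp: C_def)
  moreover have "(\<Sum>e\<in>C. c e) = flow_value G s t x"
  proof -
    have "f e * (indicat_real R (fst e) - indicat_real R (snd e)) = (if e \<in> C then c e else 0)"
      if e: "e \<in> parcs G" for e
    proof -
      have "c e \<le> f e" if "e \<in> C"
        using closed[of "fst e" "snd e"] that by (fastforce simp: C_def residual_def)
      moreover have "f e \<le> 0" if "fst e \<notin> R" "snd e \<in> R"
        using closed[of "snd e" "fst e"] that e by (fastforce simp: residual_def)
      ultimately show ?thesis
        using f[OF e] e by (auto simp: C_def indicator_def)
    qed
    then have "(\<Sum>e\<in>parcs G. f e * (indicat_real R (fst e) - indicat_real R (snd e)))
        = (\<Sum>e\<in>parcs G. if e \<in> C then c e else 0)"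
      by (rule sum.cong[OF refl])
    also have "\<dots> = (\<Sum>e\<in>C. c e)"
      using finite_parcs by (intro sum.mono_neutral_cong_right) (auto simp: C_def)
    finally show ?thesis
      using f_carries sR tR unfolding carries_def by simp
  qed
  ultimately show ?thesis
    by (intro exI[of _ C]) (auto simp: C_def)
qed

section \<open>The attack game\<close>

abbreviation "\<F> \<equiv> feasible_flows G s t c"
abbreviation "\<A> \<equiv> attacks G"
abbreviation "val \<equiv> flow_value G s t"
abbreviation "cost \<equiv> transport_cost G s t b"

section \<open>Bounds on feasible flows and compactness\<close>

lemma feasible_nonneg: "x \<in> \<F> \<Longrightarrow> l \<in> routes G s t \<Longrightarrow> 0 \<le> x l"
  by (auto simp: feasible_flows_def PiE_iff)

lemma feasible_path_nonneg: "x \<in> \<F> \<Longrightarrow> l \<in> st_paths G s t \<Longrightarrow> 0 \<le> x l"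
  by (rule feasible_nonneg) (auto simp: routes_def)

lemma loop_nonempty: "l \<in> loops G \<Longrightarrow> l \<noteq> {}"
  by (auto simp: loops_def cycle_def)

lemma route_nonempty: "l \<in> routes G s t \<Longrightarrow> l \<noteq> {}"
  using loop_nonempty st_path_nonempty by (auto simp: routes_def)

text \<open>Every route has an arc, whose capacity bounds the amount; the total capacity is a bound
  uniform in the route.\<close>

lemma feasible_le:
  assumes "x \<in> \<F>" "l \<in> routes G s t"
  shows "x l \<le> (\<Sum>e\<in>parcs G. c e)"
proof -
  obtain e where e: "e \<in> l" "e \<in> parcs G"
    using route_nonempty[OF assms(2)] routes_subset assms(2) by blast
  have "x l \<le> edge_flow G s t x e"
    unfolding edge_flow_def using finite_routes assms e(1) feasible_nonneg[OF assms(1)]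
    by (intro member_le_sum) auto
  also have "\<dots> \<le> c e" using assms(1) e(2) by (simp add: feasible_flows_def)
  also have "\<dots> \<le> (\<Sum>e\<in>parcs G. c e)"
    using e(2) capacity_pos finite_parcs by (intro member_le_sum) (auto intro: less_imp_le)
  finally show ?thesis .
qed

lemma continuous_coordinate [continuous_intros]: "continuous_on S (\<lambda>x::'v flow. x l)"
  by (rule continuous_on_subset[OF continuous_on_product_coordinates]) simp

text \<open>The function space may be an infinite product, but extensionality pins all coordinates
  outside the routes to \<open>undefined\<close>; the feasible flows are thus a closed part of a
  compact box by Tychonoff.\<close>

lemma compact_feasible: "compact \<F>"
proof -
  let ?M = "\<Sum>e\<in>parcs G. c e"
  let ?K = "PiE UNIV (\<lambda>l. if l \<in> routes G s t then {0..?M} else {undefined :: real})"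
  have "compactin (product_topology (\<lambda>_. euclidean) UNIV) ?K"
    unfolding compactin_PiE by simp
  then have "compact ?K"
    by (simp add: euclidean_product_topology)
  moreover have "closed {x :: 'v flow. edge_flow G s t x e \<le> c e}" for e
    unfolding edge_flow_def by (intro closed_Collect_le continuous_intros)
  then have "closed (\<Inter>e\<in>parcs G. {x. edge_flow G s t x e \<le> c e})"
    by (intro closed_INT) auto
  moreover have "\<F> = ?K \<inter> (\<Inter>e\<in>parcs G. {x. edge_flow G s t x e \<le> c e})"
    using feasible_le by (auto simp: feasible_flows_def PiE_iff extensional_def split: if_splits)
  ultimately show ?thesis by (simp only: compact_Int_closed)
qed

lemma cost_eq: "cost x = (\<Sum>l\<in>routes G s t. x l * route_cost b l)"
  unfolding transport_cost_def edge_flow_def route_cost_def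
  using sum_route_swap[OF finite_parcs routes_subset, of x b] by (simp add: mult.commute)

text \<open>Path flow costs at least \<open>\<alpha>\<close> per unit, and loops only add
  cost.\<close>

lemma min_path_cost_value_le:
  assumes "x \<in> \<F>"
  shows "min_path_cost G s t b * val x \<le> cost x"
proof -
  have "min_path_cost G s t b * val x = (\<Sum>l\<in>st_paths G s t. x l * min_path_cost G s t b)"
    by (simp add: flow_value_def sum_distrib_left mult.commute)
  also have "\<dots> \<le> (\<Sum>l\<in>st_paths G s t. x l * route_cost b l)"
    using feasible_path_nonneg[OF assms] by (intro sum_mono mult_left_mono min_path_cost_le)
  also have "\<dots> \<le> cost x"
    unfolding cost_eq using finite_routes feasible_nonneg[OF assms] route_cost_nonneg
    by (intro sum_mono2) (auto simp: routes_def)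
  finally show ?thesis .
qed

lemma value_nonneg: "x \<in> \<F> \<Longrightarrow> 0 \<le> val x"
  unfolding flow_value_def by (intro sum_nonneg feasible_path_nonneg)

lemma cost_nonneg: "x \<in> \<F> \<Longrightarrow> 0 \<le> cost x"
  using min_path_cost_value_le[of x] value_nonneg[of x] min_path_cost_pos
  by (meson order_trans less_imp_le mult_nonneg_nonneg)

lemma value_le_max:
  assumes "x \<in> \<F>"
  shows "val x \<le> max_flow_value G s t c"
proof -
  have "val y \<le> (\<Sum>l\<in>st_paths G s t. \<Sum>e\<in>parcs G. c e)" if "y \<in> \<F>" for y
    unfolding flow_value_def using feasible_le[OF that] by (intro sum_mono) (auto simp: routes_def)
  then have "bdd_above (val ` \<F>)" by (intro bdd_aboveI2)
  then show ?thesis unfolding max_flow_value_def using assms by (intro cSUP_upper)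
qed

section \<open>Payoffs through the lost flow F(x) - F(x^mu)\<close>

definition lost :: "'v flow \<Rightarrow> 'v attack \<Rightarrow> real" where
  "lost x \<mu> = (\<Sum>l\<in>st_paths G s t. if \<exists>e\<in>l. \<mu> e = 1 then x l else 0)"

lemma value_effective: "val (effective_flow G s t x \<mu>) = val x - lost x \<mu>"
  unfolding flow_value_def effective_flow_def lost_def sum_subtractf[symmetric]
  by (intro sum.cong) (auto simp: routes_def)

lemma value_diff_effective: "val (flow_diff G s t x (effective_flow G s t x \<mu>)) = lost x \<mu>"
  unfolding flow_value_def effective_flow_def flow_diff_def lost_def
  by (intro sum.cong) (auto simp: routes_def)

lemma payoff1_eq: "payoff1 G s t b p1 x \<mu> = p1 * (val x - lost x \<mu>) - cost x"
  by (simp add: payoff1_def value_effective)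

lemma payoff2_eq: "payoff2 G s t c p2 x \<mu> = p2 * lost x \<mu> - attack_cost G c \<mu>"
  by (simp add: payoff2_def value_diff_effective)

lemma attack_nonneg: "\<mu> \<in> \<A> \<Longrightarrow> e \<in> parcs G \<Longrightarrow> 0 \<le> \<mu> e"
  by (force simp: attacks_def PiE_iff)

lemma attack_cost_nonneg: "\<mu> \<in> \<A> \<Longrightarrow> 0 \<le> attack_cost G c \<mu>"
  unfolding attack_cost_def using attack_nonneg capacity_pos
  by (intro sum_nonneg mult_nonneg_nonneg) (auto intro: less_imp_le)

text \<open>A union bound: the loss on a path is at most its amount times its number of disrupted
  arcs. Counted by arcs, this is the load on disrupted arcs, which the capacities bound.\<close>

lemma lost_le_attack_cost:
  assumes x: "x \<in> \<F>" and \<mu>: "\<mu> \<in> \<A>"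
  shows "lost x \<mu> \<le> attack_cost G c \<mu>"
proof -
  have sub: "st_paths G s t \<subseteq> Pow (parcs G)" using st_path_subset by auto
  have "lost x \<mu> \<le> (\<Sum>l\<in>st_paths G s t. x l * (\<Sum>e\<in>l. \<mu> e))"
    unfolding lost_def
  proof (rule sum_mono)
    fix l assume l: "l \<in> st_paths G s t"
    have nn: "\<And>e. e \<in> l \<Longrightarrow> 0 \<le> \<mu> e" and fin: "finite l"
      using st_path_subset[OF l] attack_nonneg[OF \<mu>] finite_parcs by (auto intro: finite_subset)
    have "1 \<le> (\<Sum>e\<in>l. \<mu> e)" if "e \<in> l" "\<mu> e = 1" for e
      using member_le_sum[of e l \<mu>] that nn fin by auto
    moreover have "0 \<le> (\<Sum>e\<in>l. \<mu> e)" using nn by (rule sum_nonneg)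
    ultimately show "(if \<exists>e\<in>l. \<mu> e = 1 then x l else 0) \<le> x l * (\<Sum>e\<in>l. \<mu> e)"
      using feasible_path_nonneg[OF x l] mult_left_mono[of 1 "\<Sum>e\<in>l. \<mu> e" "x l"] by auto
  qed
  also have "\<dots> = (\<Sum>e\<in>parcs G. path_edge_flow x e * \<mu> e)"
    unfolding path_edge_flow_def using sum_route_swap[OF finite_parcs sub] by simp
  also have "\<dots> \<le> attack_cost G c \<mu>"
    unfolding attack_cost_def
    using path_edge_flow_le[OF x] attack_nonneg[OF \<mu>] by (intro sum_mono mult_right_mono)
  finally show ?thesis .
qed

text \<open>Assumption 1 prices the paths of x but not its loops. Minimality of the cost deals with
  these, since stripping them keeps the value and the feasibility.\<close>

lemma cheapest_max_flow:
  assumes "cheapest_path_assumption G s t c b"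
  obtains x where "x \<in> \<F>" "\<And>y. y \<in> \<F> \<Longrightarrow> val y \<le> val x"
    "cost x \<le> min_path_cost G s t b * val x"
proof -
  obtain x where x: "x \<in> min_cost_max_flows G s t c b"
    and cheap: "\<And>l. l \<in> st_paths G s t \<Longrightarrow> 0 < x l \<Longrightarrow> route_cost b l = min_path_cost G s t b"
    using assms unfolding cheapest_path_assumption_def by auto
  have xF: "x \<in> \<F>" and v: "val x = max_flow_value G s t c"
    and min: "\<And>y. y \<in> \<F> \<Longrightarrow> val y = val x \<Longrightarrow> \<not> cost y < cost x"
    using x by (auto simp: min_cost_max_flows_def is_arg_min_def)
  let ?y = "\<lambda>l\<in>routes G s t. if l \<in> st_paths G s t then x l else 0"
  have "?y \<in> \<F>" "val ?y = val x"
    using path_flow_feasible[of x] feasible_path_nonneg[OF xF] path_edge_flow_le[OF xF] by auto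
  from min[OF this] have "cost x \<le> cost ?y" by simp
  also have "\<dots> = (\<Sum>l\<in>st_paths G s t. x l * route_cost b l)"
    unfolding cost_eq using finite_routes
    by (intro sum.mono_neutral_cong_right) (auto simp: routes_def)
  also have "\<dots> = (\<Sum>l\<in>st_paths G s t. x l * min_path_cost G s t b)"
    using cheap feasible_path_nonneg[OF xF] by (intro sum.cong) (auto simp: order_less_le)
  also have "\<dots> = min_path_cost G s t b * val x"
    by (simp add: flow_value_def sum_distrib_left mult.commute)
  finally have "cost x \<le> min_path_cost G s t b * val x" .
  with that xF v value_le_max show thesis by auto
qed

section \<open>The distinguished actions and the resulting game\<close>

lemma cut_attack:
  assumes "C \<subseteq> parcs G" "\<And>l. l \<in> st_paths G s t \<Longrightarrow> l \<inter> C \<noteq> {}"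
  defines "\<mu> \<equiv> (\<lambda>e\<in>parcs G. if e \<in> C then 1 else 0)"
  shows "\<mu> \<in> \<A>" "lost x \<mu> = val x" "attack_cost G c \<mu> = (\<Sum>e\<in>C. c e)"
proof -
  show "\<mu> \<in> \<A>" by (auto simp: \<mu>_def attacks_def)
  have "\<exists>e\<in>l. \<mu> e = 1" if "l \<in> st_paths G s t" for l
    using assms(1) assms(2)[OF that] by (auto simp: \<mu>_def)
  then show "lost x \<mu> = val x"
    unfolding lost_def flow_value_def by (intro sum.cong) auto
  show "attack_cost G c \<mu> = (\<Sum>e\<in>C. c e)"
    unfolding attack_cost_def using finite_parcs assms(1)
    by (intro sum.mono_neutral_cong_right) (auto simp: \<mu>_def)
qed

lemma idle_attack:
  defines "\<mu> \<equiv> (\<lambda>e\<in>parcs G. 0)"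
  shows "\<mu> \<in> \<A>" "lost x \<mu> = 0" "attack_cost G c \<mu> = 0"
proof -
  show "\<mu> \<in> \<A>" by (auto simp: \<mu>_def attacks_def)
  have "\<mu> e \<noteq> 1" if "e \<in> l" "l \<in> st_paths G s t" for e l
    using st_path_subset[OF that(2)] that(1) by (auto simp: \<mu>_def)
  then show "lost x \<mu> = 0"
    unfolding lost_def by (intro sum.neutral) auto
  show "attack_cost G c \<mu> = 0" by (simp add: attack_cost_def \<mu>_def)
qed

lemma zero_flow:
  defines "x \<equiv> (\<lambda>l\<in>routes G s t. 0)"
  shows "x \<in> \<F>" "val x = 0" "lost x \<mu> = 0" "cost x = 0"
proof -
  have z: "val x = 0" "edge_flow G s t x e = 0" for e
    by (simp_all add: x_def flow_value_def edge_flow_def routes_def)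
  then show "val x = 0" "x \<in> \<F>"
    using capacity_pos by (auto simp: feasible_flows_def x_def intro: less_imp_le)
  show "lost x \<mu> = 0" "cost x = 0"
    using z by (auto simp: lost_def x_def routes_def transport_cost_def intro!: sum.neutral)
qed

lemma separable_attack_game:
  assumes "cheapest_path_assumption G s t c b" "min_path_cost G s t b < p1" "1 < p2"
  shows "\<exists>h k q r x0 x1 y0 y1. separable_game \<F> \<A> (payoff1 G s t b p1) (payoff2 G s t c p2)
    h k (1 / p1) (1 / p2) q r x0 x1 y0 y1"
proof -
  let ?\<alpha> = "min_path_cost G s t b"
  have \<alpha>: "0 < ?\<alpha>" by (rule min_path_cost_pos)
  have p1: "0 < p1" using \<alpha> assms(2) by simp
  obtain x where x: "x \<in> \<F>" "\<And>y. y \<in> \<F> \<Longrightarrow> val y \<le> val x" "cost x \<le> ?\<alpha> * val x"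
    using cheapest_max_flow[OF assms(1)] by blast
  obtain C where C: "C \<subseteq> parcs G" "\<And>l. l \<in> st_paths G s t \<Longrightarrow> l \<inter> C \<noteq> {}" "(\<Sum>e\<in>C. c e) = val x"
    using max_flow_min_cut[OF x(1,2)] by auto
  note cut = cut_attack[OF C(1,2)]
  have cont_val: "continuous_on S val" and cont_lost: "continuous_on S (\<lambda>x. lost x \<mu>)"
    and cont_cost: "continuous_on S cost" for S \<mu>
  proof -
    show "continuous_on S val" unfolding flow_value_def by (intro continuous_intros)
    show "continuous_on S cost" unfolding cost_eq by (intro continuous_intros)
    have "continuous_on S (\<lambda>x. if P then x l else (0::real))" for P and l :: "'v route"
      by (cases P) (auto intro!: continuous_intros)
    then show "continuous_on S (\<lambda>x. lost x \<mu>)" unfolding lost_def by (intro continuous_on_sum)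
  qed
  have "separable_game \<F> \<A> (payoff1 G s t b p1) (payoff2 G s t c p2)
    (\<lambda>x. val x - cost x / p1) (\<lambda>\<mu>. - attack_cost G c \<mu> / p2) (1 / p1) (1 / p2)
    (?\<alpha> / p1) (1 / p2) (\<lambda>l\<in>routes G s t. 0) x (\<lambda>e\<in>parcs G. 0) (\<lambda>e\<in>parcs G. if e \<in> C then 1 else 0)"
    unfolding payoff1_eq payoff2_eq
  proof
    show "finite \<A>" unfolding attacks_def using finite_parcs by (intro finite_PiE) auto
    show "compact \<F>" by (rule compact_feasible)
    show "x \<in> \<F>" by fact
    show "continuous_on \<F> (\<lambda>x. p1 * (val x - lost x \<mu>) - cost x)"
      "continuous_on \<F> (\<lambda>x. p2 * lost x \<mu> - attack_cost G c \<mu>)"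
      "continuous_on \<F> (\<lambda>x. val x - cost x / p1)" for \<mu>
      using p1 by (intro continuous_intros cont_val cont_lost cont_cost; simp)+
    show "1 / p1 * (p1 * (val x - lost x \<mu>) - cost x) + 1 / p2 * (p2 * lost x \<mu> - attack_cost G c \<mu>)
        = (val x - cost x / p1) + - attack_cost G c \<mu> / p2" for x \<mu>
      using p1 assms(3) by (simp add: field_simps)
    \<comment> \<open>Under the cut the payoff is \<open>- cost x\<close>, without attack
      \<open>p1 * val x - cost x\<close>; the weights average them to
      \<open>\<alpha> * val x - cost x\<close>.\<close>
    show "(1 - ?\<alpha> / p1) * (p1 * (val x - lost x (\<lambda>e\<in>parcs G. if e \<in> C then 1 else 0)) - cost x) +
        ?\<alpha> / p1 * (p1 * (val x - lost x (\<lambda>e\<in>parcs G. 0)) - cost x) \<le> 0" if "x \<in> \<F>" for x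
      using min_path_cost_value_le[OF that] p1
      by (simp add: cut(2) idle_attack(2)) (simp add: field_simps)
    show "0 \<le> (1 - ?\<alpha> / p1) * (p1 * (val x - lost x (\<lambda>e\<in>parcs G. if e \<in> C then 1 else 0)) - cost x) +
        ?\<alpha> / p1 * (p1 * (val x - lost x (\<lambda>e\<in>parcs G. 0)) - cost x)"
      using x(3) p1
      by (simp add: cut(2) idle_attack(2)) (simp add: field_simps)
    \<comment> \<open>The weight cancels \<open>p2\<close> and leaves
      \<open>lost x \<mu> - attack_cost G c \<mu>\<close>.\<close>
    show "1 / p2 * (p2 * lost x \<mu> - attack_cost G c \<mu>) +
        (1 - 1 / p2) * (p2 * lost (\<lambda>l\<in>routes G s t. 0) \<mu> - attack_cost G c \<mu>) \<le> 0" if "\<mu> \<in> \<A>" for \<mu>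
      using lost_le_attack_cost[OF x(1) that] assms(3)
      by (simp add: zero_flow) (simp add: field_simps)
    \<comment> \<open>For the cut, both terms of that difference equal \<open>val x\<close>.\<close>
    show "0 \<le> 1 / p2 * (p2 * lost x (\<lambda>e\<in>parcs G. if e \<in> C then 1 else 0)
          - attack_cost G c (\<lambda>e\<in>parcs G. if e \<in> C then 1 else 0)) +
        (1 - 1 / p2) * (p2 * lost (\<lambda>l\<in>routes G s t. 0) (\<lambda>e\<in>parcs G. if e \<in> C then 1 else 0)
          - attack_cost G c (\<lambda>e\<in>parcs G. if e \<in> C then 1 else 0))"
      using assms(3) by (simp add: zero_flow cut(2) cut(3) C(3)) (simp add: field_simps)
  \<comment> \<open>Here p1 > \<alpha> > 0 and p2 > 1 put both mixing weights strictly between 0 and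
    1.\<close>
  qed (use p1 \<alpha> assms(2,3) zero_flow cut idle_attack cost_nonneg attack_cost_nonneg in auto)
  then show ?thesis by blast
qed

end

theorem proposition7:
  fixes G :: "'v pair_pre_digraph" and s t :: 'v
    and c b :: "'v \<times> 'v \<Rightarrow> real" and p1 p2 :: real
  defines "\<Delta>F \<equiv> mixed_strategies (feasible_flows G s t c)"
    and "\<Delta>A \<equiv> mixed_strategies (attacks G)"
    and "V1 \<equiv> U1 G s t c b p1"
    and "V2 \<equiv> U2 G s t c p2"
  assumes "flow_network G s t c b"
    and "p1 > 0" and "p2 > 0"
    and "cheapest_path_assumption G s t c b"
    and "p1 > min_path_cost G s t b" and "p2 > 1"
  shows "has_maximin \<Delta>F \<Delta>A V1 0 \<and>
    has_minimax \<Delta>A \<Delta>F (\<lambda>\<sigma>2 \<sigma>1. V1 \<sigma>1 \<sigma>2) 0 \<and>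
    has_maximin \<Delta>A \<Delta>F (\<lambda>\<sigma>2 \<sigma>1. V2 \<sigma>1 \<sigma>2) 0 \<and>
    has_minimax \<Delta>F \<Delta>A V2 0 \<and>
    {(V1 \<sigma>1 \<sigma>2, V2 \<sigma>1 \<sigma>2) | \<sigma>1 \<sigma>2. (\<sigma>1, \<sigma>2) \<in> nash_equilibria \<Delta>F \<Delta>A V1 V2} = {(0, 0)} \<and>
    (\<forall>(\<sigma>1, \<sigma>2) \<in> nash_equilibria \<Delta>F \<Delta>A V1 V2.
             minimaximizer \<Delta>F \<Delta>A V2 \<sigma>1 \<and>
             minimaximizer \<Delta>A \<Delta>F (\<lambda>\<sigma>2 \<sigma>1. V1 \<sigma>1 \<sigma>2) \<sigma>2)"
proof -
  interpret flow_network G s t c b by fact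
  obtain h k q r x0 x1 y0 y1 where
    "separable_game \<F> \<A> (payoff1 G s t b p1) (payoff2 G s t c p2) h k (1 / p1) (1 / p2) q r x0 x1 y0 y1"
    using separable_attack_game assms by blast
  then interpret separable_game \<F> \<A> "payoff1 G s t b p1" "payoff2 G s t c p2"
    h k "1 / p1" "1 / p2" q r x0 x1 y0 y1 .
  have V: "V1 = (\<lambda>\<sigma>1 \<sigma>2. E1 \<sigma>1 \<sigma>2)" "V2 = (\<lambda>\<sigma>1 \<sigma>2. E2 \<sigma>1 \<sigma>2)"
    by (simp_all add: V1_def V2_def U1_def U2_def fun_eq_iff)
  show ?thesis
    unfolding V \<Delta>F_def \<Delta>A_def
    using maximin1 minimax1 maximin2 minimax2 nash_payoffs nash_minimaximizer by blast
qed

end
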